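(* Let ${\rm LZFC}^{sext}$ be the theory ${\rm BST}+Loc^{sext}({\rm ZFC})$. Then: (i) ${\rm LZFC}^{sext}\vdash {\rm Powerset}$. (ii) ${\rm LZFC}^{sext}\vdash \Sigma_1\text{-Collection}$, i.e., for every $\Sigma_1$ formula $\phi(x,y,\overline{c})$ with parameters $\overline c$, ${\rm LZFC}^{sext}$ proves that for every set $a$, if $(\forall x\in a)(\exists y)\phi(x,y,\overline{c})$ then there is a set $b$ such that $(\forall x\in a)(\exists y\in b)\phi(x,y,\overline{c})$.
   Context: All theories are in the language $\{\in\}$. BST is the theory with axioms: Empty set, Extensionality, Pair, Union, Cartesian Product, "$\omega$ exists", and $\Delta_0$-Separation. "Model" means a (set) transitive model of ZFC, with membership as the $\in$-relation. A model $M$ is strongly extendible if for every set $x$ there is a model $N$ such that $x\in N$ and $M\prec N$ (elementary submodel). $Loc^{sext}({\rm ZFC})$ is the statement: every set $x$ belongs to some strongly extendible (transitive) model of ZFC. (${\rm LZFC}={\rm BST}+Loc({\rm ZFC})$, where $Loc({\rm ZFC})$ says that every set belongs to a transitive model of ZFC, so ${\rm LZFC}^{sext}={\rm LZFC}+Loc^{sext}({\rm ZFC})$.) A $\Sigma_1$ formula is one of the form $(\exists \overline{z})\psi$ with $\psi$ bounded ($\Delta_0$) and $\overline z$ a tuple of variables. *)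

theory Defs
  imports Main
begin

section \<open>First-order logic in the language of set theory\<close>

text \<open>Variables are de Bruijn indices; the only terms are variables.\<close>

datatype fm =
    Mem nat nat
  | Equal nat nat
  | Fls
  | Imp fm fm
  | Forall fm

definition Neg :: "fm \<Rightarrow> fm" where "Neg p = Imp p Fls"
definition And :: "fm \<Rightarrow> fm \<Rightarrow> fm" where "And p q = Neg (Imp p (Neg q))"
definition Or :: "fm \<Rightarrow> fm \<Rightarrow> fm" where "Or p q = Imp (Neg p) q"
definition Iff :: "fm \<Rightarrow> fm \<Rightarrow> fm" where "Iff p q = And (Imp p q) (Imp q p)"
definition Exists :: "fm \<Rightarrow> fm" where "Exists p = Neg (Forall (Neg p))"

primrec ren :: "(nat \<Rightarrow> nat) \<Rightarrow> fm \<Rightarrow> fm" where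
  "ren f (Mem i j) = Mem (f i) (f j)"
| "ren f (Equal i j) = Equal (f i) (f j)"
| "ren f Fls = Fls"
| "ren f (Imp p q) = Imp (ren f p) (ren f q)"
| "ren f (Forall p) = Forall (ren (case_nat 0 (\<lambda>i. Suc (f i))) p)"

text \<open>\<open>lift k p\<close> inserts a new variable, not occurring free in the result, at index \<open>k\<close>;
  \<open>inst t p\<close> substitutes the variable \<open>t\<close> for index \<open>0\<close> and decrements the other indices.\<close>

definition lift :: "nat \<Rightarrow> fm \<Rightarrow> fm" where
  "lift k = ren (\<lambda>i. if i < k then i else Suc i)"

definition inst :: "nat \<Rightarrow> fm \<Rightarrow> fm" where
  "inst t = ren (case_nat t (\<lambda>i. i))"

text \<open>All free variables of \<open>p\<close> are below \<open>arity p\<close>.\<close>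

primrec arity :: "fm \<Rightarrow> nat" where
  "arity (Mem i j) = max (Suc i) (Suc j)"
| "arity (Equal i j) = max (Suc i) (Suc j)"
| "arity Fls = 0"
| "arity (Imp p q) = max (arity p) (arity q)"
| "arity (Forall p) = arity p - 1"

definition univ_closure :: "fm \<Rightarrow> fm" where
  "univ_closure p = (Forall ^^ arity p) p"

text \<open>A Hilbert calculus for classical first-order logic with equality. Generalization is
  unrestricted because \<open>T\<close> is meant to be a set of sentences.\<close>

inductive provable :: "fm set \<Rightarrow> fm \<Rightarrow> bool" (infix "\<turnstile>" 40) for T :: "fm set" where
  Axiom: "p \<in> T \<Longrightarrow> T \<turnstile> p"
| MP: "T \<turnstile> Imp p q \<Longrightarrow> T \<turnstile> p \<Longrightarrow> T \<turnstile> q"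
| Gen: "T \<turnstile> p \<Longrightarrow> T \<turnstile> Forall p"
| Prop_K: "T \<turnstile> Imp p (Imp q p)"
| Prop_S: "T \<turnstile> Imp (Imp p (Imp q r)) (Imp (Imp p q) (Imp p r))"
| Prop_DN: "T \<turnstile> Imp (Neg (Neg p)) p"
| All_inst: "T \<turnstile> Imp (Forall p) (inst t p)"
| All_dist: "T \<turnstile> Imp (Forall (Imp p q)) (Imp (Forall p) (Forall q))"
| All_vacuous: "T \<turnstile> Imp p (Forall (lift 0 p))"
| Eq_refl: "T \<turnstile> Equal i i"
| Eq_subst: "T \<turnstile> Imp (Equal i j) (Imp (inst i p) (inst j p))"

inductive delta0 :: "fm \<Rightarrow> bool" where
  delta0_Mem: "delta0 (Mem i j)"
| delta0_Equal: "delta0 (Equal i j)"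
| delta0_Fls: "delta0 Fls"
| delta0_Imp: "delta0 p \<Longrightarrow> delta0 q \<Longrightarrow> delta0 (Imp p q)"
| delta0_ball: "delta0 p \<Longrightarrow> delta0 (Forall (Imp (Mem 0 (Suc i)) p))"
| delta0_bex: "delta0 p \<Longrightarrow> delta0 (Exists (And (Mem 0 (Suc i)) p))"

definition sigma1 :: "fm \<Rightarrow> bool" where
  "sigma1 p \<longleftrightarrow> (\<exists>n q. delta0 q \<and> p = (Exists ^^ n) q)"


section \<open>Writing formulas with named bound variables\<close>

text \<open>To keep concrete formulas readable they are written with HOL-bound variables. A term of
  type \<open>sform\<close> yields a formula once the number \<open>d\<close> of enclosing quantifiers is given; a
  variable is represented by its de Bruijn level, that is, by the number of quantifiers that
  enclose its own binder. Thus level \<open>x\<close> becomes index \<open>d - Suc x\<close> at depth \<open>d\<close>, and a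
  sentence \<open>P\<close> is turned into a formula by \<open>P 0\<close>. Terms of
  type \<open>var\<close> always stand for variables of the object language.\<close>

type_synonym var = nat
type_synonym sform = "nat \<Rightarrow> fm"

definition s_mem :: "var \<Rightarrow> var \<Rightarrow> sform" (infix "\<^bold>\<in>" 50) where
  "(x \<^bold>\<in> y) = (\<lambda>d. Mem (d - Suc x) (d - Suc y))"
definition s_eq :: "var \<Rightarrow> var \<Rightarrow> sform" (infix "\<^bold>=" 50) where
  "(x \<^bold>= y) = (\<lambda>d. Equal (d - Suc x) (d - Suc y))"
definition s_not :: "sform \<Rightarrow> sform" ("\<^bold>\<not> _" [40] 40) where
  "(\<^bold>\<not> P) = (\<lambda>d. Neg (P d))"
definition s_and :: "sform \<Rightarrow> sform \<Rightarrow> sform" (infixr "\<^bold>\<and>" 35) where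
  "(P \<^bold>\<and> Q) = (\<lambda>d. And (P d) (Q d))"
definition s_or :: "sform \<Rightarrow> sform \<Rightarrow> sform" (infixr "\<^bold>\<or>" 30) where
  "(P \<^bold>\<or> Q) = (\<lambda>d. Or (P d) (Q d))"
definition s_imp :: "sform \<Rightarrow> sform \<Rightarrow> sform" (infixr "\<^bold>\<longrightarrow>" 25) where
  "(P \<^bold>\<longrightarrow> Q) = (\<lambda>d. Imp (P d) (Q d))"
definition s_iff :: "sform \<Rightarrow> sform \<Rightarrow> sform" (infixr "\<^bold>\<longleftrightarrow>" 25) where
  "(P \<^bold>\<longleftrightarrow> Q) = (\<lambda>d. Iff (P d) (Q d))"
definition s_all :: "(var \<Rightarrow> sform) \<Rightarrow> sform" (binder "\<^bold>\<forall>" 10) where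
  "s_all P = (\<lambda>d. Forall (P d (Suc d)))"
definition s_ex :: "(var \<Rightarrow> sform) \<Rightarrow> sform" (binder "\<^bold>\<exists>" 10) where
  "s_ex P = (\<lambda>d. Exists (P d (Suc d)))"


section \<open>Basic set-theoretic vocabulary\<close>

definition is_empty :: "var \<Rightarrow> sform" where
  "is_empty x = (\<^bold>\<forall>y. \<^bold>\<not> y \<^bold>\<in> x)"

definition is_subset :: "var \<Rightarrow> var \<Rightarrow> sform" where
  "is_subset x y = (\<^bold>\<forall>z. z \<^bold>\<in> x \<^bold>\<longrightarrow> z \<^bold>\<in> y)"

definition is_upair :: "var \<Rightarrow> var \<Rightarrow> var \<Rightarrow> sform" where
  "is_upair z x y = (\<^bold>\<forall>u. u \<^bold>\<in> z \<^bold>\<longleftrightarrow> u \<^bold>= x \<^bold>\<or> u \<^bold>= y)"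

definition is_pair :: "var \<Rightarrow> var \<Rightarrow> var \<Rightarrow> sform" where
  "is_pair p x y = (\<^bold>\<exists>a b. is_upair a x x \<^bold>\<and> is_upair b x y \<^bold>\<and> is_upair p a b)"

definition is_triple :: "var \<Rightarrow> var \<Rightarrow> var \<Rightarrow> var \<Rightarrow> sform" where
  "is_triple t x y z = (\<^bold>\<exists>p. is_pair p y z \<^bold>\<and> is_pair t x p)"

definition is_union :: "var \<Rightarrow> var \<Rightarrow> sform" where
  "is_union u x = (\<^bold>\<forall>z. z \<^bold>\<in> u \<^bold>\<longleftrightarrow> (\<^bold>\<exists>y. y \<^bold>\<in> x \<^bold>\<and> z \<^bold>\<in> y))"

definition is_product :: "var \<Rightarrow> var \<Rightarrow> var \<Rightarrow> sform" where
  "is_product c a b =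
    (\<^bold>\<forall>p. p \<^bold>\<in> c \<^bold>\<longleftrightarrow> (\<^bold>\<exists>x y. x \<^bold>\<in> a \<^bold>\<and> y \<^bold>\<in> b \<^bold>\<and> is_pair p x y))"

definition is_succ :: "var \<Rightarrow> var \<Rightarrow> sform" where
  "is_succ y x = (\<^bold>\<forall>u. u \<^bold>\<in> y \<^bold>\<longleftrightarrow> u \<^bold>\<in> x \<^bold>\<or> u \<^bold>= x)"

definition is_inductive :: "var \<Rightarrow> sform" where
  "is_inductive w = ((\<^bold>\<exists>e. is_empty e \<^bold>\<and> e \<^bold>\<in> w) \<^bold>\<and>
    (\<^bold>\<forall>x. x \<^bold>\<in> w \<^bold>\<longrightarrow> (\<^bold>\<exists>y. is_succ y x \<^bold>\<and> y \<^bold>\<in> w)))"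

text \<open>\<open>\<omega>\<close> is the least inductive set; BST has no Foundation axiom to simplify this.\<close>

definition is_omega :: "var \<Rightarrow> sform" where
  "is_omega w = (is_inductive w \<^bold>\<and> (\<^bold>\<forall>v. is_inductive v \<^bold>\<longrightarrow> is_subset w v))"

definition is_natural :: "var \<Rightarrow> sform" where
  "is_natural n = (\<^bold>\<exists>w. is_omega w \<^bold>\<and> n \<^bold>\<in> w)"

primrec is_numeral :: "nat \<Rightarrow> var \<Rightarrow> sform" where
  "is_numeral 0 x = is_empty x"
| "is_numeral (Suc k) x = (\<^bold>\<exists>y. is_numeral k y \<^bold>\<and> is_succ x y)"

definition is_transitive :: "var \<Rightarrow> sform" where
  "is_transitive x = (\<^bold>\<forall>y. y \<^bold>\<in> x \<^bold>\<longrightarrow> is_subset y x)"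

text \<open>\<open>f(x) = y\<close>\<close>

definition is_apply :: "var \<Rightarrow> var \<Rightarrow> var \<Rightarrow> sform" where
  "is_apply f x y = (\<^bold>\<exists>p. is_pair p x y \<^bold>\<and> p \<^bold>\<in> f)"

text \<open>\<open>f\<close> is a function with domain \<open>n\<close>\<close>

definition is_function :: "var \<Rightarrow> var \<Rightarrow> sform" where
  "is_function f n =
    ((\<^bold>\<forall>p. p \<^bold>\<in> f \<^bold>\<longrightarrow> (\<^bold>\<exists>x y. x \<^bold>\<in> n \<^bold>\<and> is_pair p x y)) \<^bold>\<and>
     (\<^bold>\<forall>x. x \<^bold>\<in> n \<^bold>\<longrightarrow> (\<^bold>\<exists>y. \<^bold>\<forall>z. is_apply f x z \<^bold>\<longleftrightarrow> z \<^bold>= y)))"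

definition is_function_into :: "var \<Rightarrow> var \<Rightarrow> var \<Rightarrow> sform" where
  "is_function_into f n M = (is_function f n \<^bold>\<and> (\<^bold>\<forall>x y. is_apply f x y \<^bold>\<longrightarrow> y \<^bold>\<in> M))"


section \<open>Single axioms and axiom schemas\<close>

definition extensionality :: fm where
  "extensionality = (\<^bold>\<forall>x y. (\<^bold>\<forall>z. z \<^bold>\<in> x \<^bold>\<longleftrightarrow> z \<^bold>\<in> y) \<^bold>\<longrightarrow> x \<^bold>= y) 0"

definition empty_set :: fm where
  "empty_set = (\<^bold>\<exists>x. is_empty x) 0"

definition pairing :: fm where
  "pairing = (\<^bold>\<forall>x y. \<^bold>\<exists>z. is_upair z x y) 0"

definition union :: fm where
  "union = (\<^bold>\<forall>x. \<^bold>\<exists>u. is_union u x) 0"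

definition cartesian_product :: fm where
  "cartesian_product = (\<^bold>\<forall>a b. \<^bold>\<exists>c. is_product c a b) 0"

definition omega_exists :: fm where
  "omega_exists = (\<^bold>\<exists>w. is_omega w) 0"

definition powerset :: fm where
  "powerset = (\<^bold>\<forall>x. \<^bold>\<exists>p. \<^bold>\<forall>y. y \<^bold>\<in> p \<^bold>\<longleftrightarrow> is_subset y x) 0"

definition infinity :: fm where
  "infinity = (\<^bold>\<exists>w. is_inductive w) 0"

definition foundation :: fm where
  "foundation = (\<^bold>\<forall>x. (\<^bold>\<exists>y. y \<^bold>\<in> x) \<^bold>\<longrightarrow>
    (\<^bold>\<exists>y. y \<^bold>\<in> x \<^bold>\<and> \<^bold>\<not> (\<^bold>\<exists>z. z \<^bold>\<in> x \<^bold>\<and> z \<^bold>\<in> y))) 0"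

text \<open>Every family of nonempty, pairwise disjoint sets has a set meeting each member in exactly
  one element.\<close>

definition choice :: fm where
  "choice = (\<^bold>\<forall>F. (\<^bold>\<forall>x. x \<^bold>\<in> F \<^bold>\<longrightarrow> (\<^bold>\<exists>y. y \<^bold>\<in> x)) \<^bold>\<and>
      (\<^bold>\<forall>x y. x \<^bold>\<in> F \<^bold>\<and> y \<^bold>\<in> F \<^bold>\<and> (\<^bold>\<exists>z. z \<^bold>\<in> x \<^bold>\<and> z \<^bold>\<in> y) \<^bold>\<longrightarrow> x \<^bold>= y) \<^bold>\<longrightarrow>
      (\<^bold>\<exists>C. \<^bold>\<forall>x. x \<^bold>\<in> F \<^bold>\<longrightarrow> (\<^bold>\<exists>y. \<^bold>\<forall>z. z \<^bold>\<in> x \<^bold>\<and> z \<^bold>\<in> C \<^bold>\<longleftrightarrow> z \<^bold>= y))) 0"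

text \<open>\<open>p\<close> is \<open>\<phi>(x, a, c)\<close>, with \<open>x\<close> at index 0, \<open>a\<close> at index 1 and parameters from index 2 on:
  \<open>\<forall>a. \<exists>b. \<forall>x. x \<in> b \<longleftrightarrow> x \<in> a \<and> \<phi>\<close>.\<close>

definition separation :: "fm \<Rightarrow> fm" where
  "separation p = Forall (Exists (Forall (Iff (Mem 0 1) (And (Mem 0 2) (lift 1 p)))))"

text \<open>\<open>p\<close> is \<open>\<phi>(y, x, a, c)\<close>, with \<open>y\<close> at index 0, \<open>x\<close> at index 1, \<open>a\<close> at index 2 and
  parameters from index 3 on:
  \<open>\<forall>a. (\<forall>x. x \<in> a \<longrightarrow> (\<exists>y. \<phi>)) \<longrightarrow> (\<exists>b. \<forall>x. x \<in> a \<longrightarrow> (\<exists>y. y \<in> b \<and> \<phi>))\<close>.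
  The set \<open>a\<close> may thus itself be used as a parameter.\<close>

definition collection :: "fm \<Rightarrow> fm" where
  "collection p = Forall (Imp
     (Forall (Imp (Mem 0 1) (Exists p)))
     (Exists (Forall (Imp (Mem 0 2) (Exists (And (Mem 0 2) (lift 2 p)))))))"

definition BST :: "fm set" where
  "BST = {empty_set, extensionality, pairing, union, cartesian_product, omega_exists} \<union>
     {univ_closure (separation p) | p. delta0 p}"


section \<open>Formulas as sets\<close>

text \<open>The remaining notions are formulated inside set theory, and hence speak about all
  formulas in the sense of the theory, including nonstandard ones. The codes are
  \<open>(0,(i,j))\<close> for \<open>Mem i j\<close>, \<open>(1,(i,j))\<close> for \<open>Equal i j\<close>, \<open>(2,0)\<close> for \<open>Fls\<close>,
  \<open>(3,(a,b))\<close> for implication and \<open>(4,a)\<close> for universal quantification.\<close>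

definition is_tagged :: "nat \<Rightarrow> var \<Rightarrow> var \<Rightarrow> sform" where
  "is_tagged k c x = (\<^bold>\<exists>t. is_numeral k t \<^bold>\<and> is_pair c t x)"

definition code_Mem :: "var \<Rightarrow> var \<Rightarrow> var \<Rightarrow> sform" where
  "code_Mem c i j = (\<^bold>\<exists>p. is_pair p i j \<^bold>\<and> is_tagged 0 c p)"

definition code_Equal :: "var \<Rightarrow> var \<Rightarrow> var \<Rightarrow> sform" where
  "code_Equal c i j = (\<^bold>\<exists>p. is_pair p i j \<^bold>\<and> is_tagged 1 c p)"

definition code_Fls :: "var \<Rightarrow> sform" where
  "code_Fls c = (\<^bold>\<exists>e. is_empty e \<^bold>\<and> is_tagged 2 c e)"

definition code_Imp :: "var \<Rightarrow> var \<Rightarrow> var \<Rightarrow> sform" where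
  "code_Imp c a b = (\<^bold>\<exists>p. is_pair p a b \<^bold>\<and> is_tagged 3 c p)"

definition code_Forall :: "var \<Rightarrow> var \<Rightarrow> sform" where
  "code_Forall c a = is_tagged 4 c a"

text \<open>\<open>z\<close> is the last entry of a finite sequence each of whose entries \<open>u\<close> satisfies
  \<open>R E u\<close>, where \<open>E v\<close> says that \<open>v\<close> occurs in the sequence before \<open>u\<close>.\<close>

definition is_constructed :: "((var \<Rightarrow> sform) \<Rightarrow> var \<Rightarrow> sform) \<Rightarrow> var \<Rightarrow> sform" where
  "is_constructed R z = (\<^bold>\<exists>n m f. is_natural n \<^bold>\<and> is_succ m n \<^bold>\<and> is_function f m \<^bold>\<and>
     is_apply f n z \<^bold>\<and>
     (\<^bold>\<forall>k u. is_apply f k u \<^bold>\<longrightarrow> R (\<lambda>v. \<^bold>\<exists>j. j \<^bold>\<in> k \<^bold>\<and> is_apply f j v) u))"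

text \<open>\<open>c\<close> is the code of a formula all of whose free variables are below \<open>n\<close>.\<close>

definition is_formula_step :: "(var \<Rightarrow> sform) \<Rightarrow> var \<Rightarrow> sform" where
  "is_formula_step E u = (\<^bold>\<exists>c n. is_pair u c n \<^bold>\<and> is_natural n \<^bold>\<and>
     ((\<^bold>\<exists>i j. i \<^bold>\<in> n \<^bold>\<and> j \<^bold>\<in> n \<^bold>\<and> (code_Mem c i j \<^bold>\<or> code_Equal c i j)) \<^bold>\<or>
      code_Fls c \<^bold>\<or>
      (\<^bold>\<exists>a b v w. code_Imp c a b \<^bold>\<and> is_pair v a n \<^bold>\<and> E v \<^bold>\<and> is_pair w b n \<^bold>\<and> E w) \<^bold>\<or>
      (\<^bold>\<exists>a m v. code_Forall c a \<^bold>\<and> is_succ m n \<^bold>\<and> is_pair v a m \<^bold>\<and> E v)))"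

definition is_formula :: "var \<Rightarrow> var \<Rightarrow> sform" where
  "is_formula c n = (\<^bold>\<exists>z. is_pair z c n \<^bold>\<and> is_constructed is_formula_step z)"

text \<open>The counterpart of \<^const>\<open>lift\<close>: \<open>c'\<close> is the code of the formula with code \<open>c\<close>, lifted
  at \<open>k\<close>.\<close>

definition is_lift_var :: "var \<Rightarrow> var \<Rightarrow> var \<Rightarrow> sform" where
  "is_lift_var k i i' = (is_natural i \<^bold>\<and>
     ((i \<^bold>\<in> k \<^bold>\<and> i' \<^bold>= i) \<^bold>\<or> (\<^bold>\<not> i \<^bold>\<in> k \<^bold>\<and> is_succ i' i)))"

definition is_lift_step :: "(var \<Rightarrow> sform) \<Rightarrow> var \<Rightarrow> sform" where
  "is_lift_step E u = (\<^bold>\<exists>k c c'. is_triple u k c c' \<^bold>\<and> is_natural k \<^bold>\<and>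
     ((\<^bold>\<exists>i j i' j'. is_lift_var k i i' \<^bold>\<and> is_lift_var k j j' \<^bold>\<and>
         ((code_Mem c i j \<^bold>\<and> code_Mem c' i' j') \<^bold>\<or> (code_Equal c i j \<^bold>\<and> code_Equal c' i' j'))) \<^bold>\<or>
      (code_Fls c \<^bold>\<and> code_Fls c') \<^bold>\<or>
      (\<^bold>\<exists>a b a' b' v w. code_Imp c a b \<^bold>\<and> code_Imp c' a' b' \<^bold>\<and>
         is_triple v k a a' \<^bold>\<and> E v \<^bold>\<and> is_triple w k b b' \<^bold>\<and> E w) \<^bold>\<or>
      (\<^bold>\<exists>a a' m v. code_Forall c a \<^bold>\<and> code_Forall c' a' \<^bold>\<and>
         is_succ m k \<^bold>\<and> is_triple v m a a' \<^bold>\<and> E v)))"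

definition is_lift :: "var \<Rightarrow> var \<Rightarrow> var \<Rightarrow> sform" where
  "is_lift k c c' = (\<^bold>\<exists>z. is_triple z k c c' \<^bold>\<and> is_constructed is_lift_step z)"

text \<open>A \<open>desc\<close> is a predicate \<open>\<lambda>c. \<dots>\<close> meaning that \<open>c\<close> is the code of a certain formula. The
  \<open>q\<close>-operations copy the connectives, and \<open>qThe a\<close> describes \<open>a\<close> itself; they serve to write
  down the codes of axiom schema instances.\<close>

type_synonym desc = "var \<Rightarrow> sform"

definition qThe :: "var \<Rightarrow> desc" where
  "qThe a = (\<lambda>c. c \<^bold>= a)"
definition qMem :: "nat \<Rightarrow> nat \<Rightarrow> desc" where
  "qMem i j = (\<lambda>c. \<^bold>\<exists>x y. is_numeral i x \<^bold>\<and> is_numeral j y \<^bold>\<and> code_Mem c x y)"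
definition qEqual :: "nat \<Rightarrow> nat \<Rightarrow> desc" where
  "qEqual i j = (\<lambda>c. \<^bold>\<exists>x y. is_numeral i x \<^bold>\<and> is_numeral j y \<^bold>\<and> code_Equal c x y)"
definition qFls :: desc where
  "qFls = code_Fls"
definition qImp :: "desc \<Rightarrow> desc \<Rightarrow> desc" where
  "qImp A B = (\<lambda>c. \<^bold>\<exists>a b. A a \<^bold>\<and> B b \<^bold>\<and> code_Imp c a b)"
definition qForall :: "desc \<Rightarrow> desc" where
  "qForall A = (\<lambda>c. \<^bold>\<exists>a. A a \<^bold>\<and> code_Forall c a)"

definition qNeg :: "desc \<Rightarrow> desc" where "qNeg A = qImp A qFls"
definition qAnd :: "desc \<Rightarrow> desc \<Rightarrow> desc" where "qAnd A B = qNeg (qImp A (qNeg B))"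
definition qIff :: "desc \<Rightarrow> desc \<Rightarrow> desc" where "qIff A B = qAnd (qImp A B) (qImp B A)"
definition qExists :: "desc \<Rightarrow> desc" where "qExists A = qNeg (qForall (qNeg A))"

text \<open>\<open>quote p c\<close>: \<open>c\<close> is the code of the formula \<open>p\<close>.\<close>

primrec quote :: "fm \<Rightarrow> desc" where
  "quote (Mem i j) = qMem i j"
| "quote (Equal i j) = qEqual i j"
| "quote Fls = qFls"
| "quote (Imp p q) = qImp (quote p) (quote q)"
| "quote (Forall p) = qForall (quote p)"

text \<open>\<open>c\<close> is the code of the instance of Separation for the formula with code \<open>a\<close>; this copies
  \<^const>\<open>separation\<close>.\<close>

definition is_separation_instance :: "var \<Rightarrow> var \<Rightarrow> sform" where
  "is_separation_instance c a = (\<^bold>\<exists>one a'. is_numeral 1 one \<^bold>\<and> is_lift one a a' \<^bold>\<and>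
     qForall (qExists (qForall (qIff (qMem 0 1) (qAnd (qMem 0 2) (qThe a'))))) c)"

text \<open>The instance of Replacement for \<open>\<phi>(y, x, A, \<dots>)\<close>, with variables ordered as in
  \<^const>\<open>collection\<close>:
  \<open>\<forall>A. (\<forall>x. x \<in> A \<longrightarrow> (\<exists>z. \<forall>y. \<phi> \<longleftrightarrow> y = z)) \<longrightarrow> (\<exists>B. \<forall>x. x \<in> A \<longrightarrow> (\<exists>y. y \<in> B \<and> \<phi>))\<close>.\<close>

definition is_replacement_instance :: "var \<Rightarrow> var \<Rightarrow> sform" where
  "is_replacement_instance c a =
     (\<^bold>\<exists>one two a' a''. is_numeral 1 one \<^bold>\<and> is_numeral 2 two \<^bold>\<and>
       is_lift one a a' \<^bold>\<and> is_lift two a a'' \<^bold>\<and>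
       qForall (qImp
         (qForall (qImp (qMem 0 1) (qExists (qForall (qIff (qThe a') (qEqual 0 1))))))
         (qExists (qForall (qImp (qMem 0 2) (qExists (qAnd (qMem 0 2) (qThe a'')))))))
       c)"

definition is_ZFC_axiom :: "var \<Rightarrow> sform" where
  "is_ZFC_axiom c =
     (quote extensionality c \<^bold>\<or> quote foundation c \<^bold>\<or> quote pairing c \<^bold>\<or> quote union c \<^bold>\<or>
      quote powerset c \<^bold>\<or> quote infinity c \<^bold>\<or> quote choice c \<^bold>\<or>
      (\<^bold>\<exists>a n. is_formula a n \<^bold>\<and> (is_separation_instance c a \<^bold>\<or> is_replacement_instance c a)))"


section \<open>Satisfaction and strongly extendible models\<close>

text \<open>Assignments are finite sequences \<open>s : n \<rightarrow> M\<close>; \<open>t\<close> is the assignment \<open>(x, s(0), s(1), \<dots>)\<close>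
  of length \<open>m = n + 1\<close>.\<close>

definition is_cons :: "var \<Rightarrow> var \<Rightarrow> var \<Rightarrow> var \<Rightarrow> sform" where
  "is_cons t m x s = (is_function t m \<^bold>\<and>
     (\<^bold>\<exists>e. is_empty e \<^bold>\<and> is_apply t e x) \<^bold>\<and>
     (\<^bold>\<forall>i j y. is_apply s i y \<^bold>\<and> is_succ j i \<^bold>\<longrightarrow> is_apply t j y))"

definition sat_in :: "var \<Rightarrow> var \<Rightarrow> var \<Rightarrow> sform" where
  "sat_in S c s = (\<^bold>\<exists>p. is_pair p c s \<^bold>\<and> p \<^bold>\<in> S)"

text \<open>The set \<open>S\<close> obeys Tarski's clauses for all pairs of a formula with free variables below
  \<open>n\<close> and an assignment \<open>s : n \<rightarrow> M\<close>, for all natural numbers \<open>n\<close>.\<close>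

definition is_satisfaction :: "var \<Rightarrow> var \<Rightarrow> sform" where
  "is_satisfaction S M = (\<^bold>\<forall>n s. is_natural n \<^bold>\<and> is_function_into s n M \<^bold>\<longrightarrow>
     (\<^bold>\<forall>c i j. i \<^bold>\<in> n \<^bold>\<and> j \<^bold>\<in> n \<^bold>\<and> code_Mem c i j \<^bold>\<longrightarrow>
        (sat_in S c s \<^bold>\<longleftrightarrow> (\<^bold>\<exists>x y. is_apply s i x \<^bold>\<and> is_apply s j y \<^bold>\<and> x \<^bold>\<in> y))) \<^bold>\<and>
     (\<^bold>\<forall>c i j. i \<^bold>\<in> n \<^bold>\<and> j \<^bold>\<in> n \<^bold>\<and> code_Equal c i j \<^bold>\<longrightarrow>
        (sat_in S c s \<^bold>\<longleftrightarrow> (\<^bold>\<exists>x y. is_apply s i x \<^bold>\<and> is_apply s j y \<^bold>\<and> x \<^bold>= y))) \<^bold>\<and>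
     (\<^bold>\<forall>c. code_Fls c \<^bold>\<longrightarrow> \<^bold>\<not> sat_in S c s) \<^bold>\<and>
     (\<^bold>\<forall>c a b. is_formula a n \<^bold>\<and> is_formula b n \<^bold>\<and> code_Imp c a b \<^bold>\<longrightarrow>
        (sat_in S c s \<^bold>\<longleftrightarrow> (sat_in S a s \<^bold>\<longrightarrow> sat_in S b s))) \<^bold>\<and>
     (\<^bold>\<forall>c a m. is_succ m n \<^bold>\<and> is_formula a m \<^bold>\<and> code_Forall c a \<^bold>\<longrightarrow>
        (sat_in S c s \<^bold>\<longleftrightarrow> (\<^bold>\<forall>x t. x \<^bold>\<in> M \<^bold>\<and> is_cons t m x s \<^bold>\<longrightarrow> sat_in S a t))))"

text \<open>\<open>M \<Turnstile> c[s]\<close>\<close>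

definition satisfies :: "var \<Rightarrow> var \<Rightarrow> var \<Rightarrow> sform" where
  "satisfies M c s = (\<^bold>\<exists>S. is_satisfaction S M \<^bold>\<and> sat_in S c s)"

text \<open>\<open>M \<Turnstile> c\<close>, i.e. \<open>M\<close> satisfies the universal closure of \<open>c\<close>. Axiom schema instances with
  parameters are thus understood as universally closed.\<close>

definition models :: "var \<Rightarrow> var \<Rightarrow> sform" where
  "models M c = (\<^bold>\<forall>n s. is_natural n \<^bold>\<and> is_formula c n \<^bold>\<and> is_function_into s n M \<^bold>\<longrightarrow>
     satisfies M c s)"

definition is_model :: "var \<Rightarrow> sform" where
  "is_model M = (is_transitive M \<^bold>\<and> (\<^bold>\<forall>c. is_ZFC_axiom c \<^bold>\<longrightarrow> models M c))"

definition is_elementary_submodel :: "var \<Rightarrow> var \<Rightarrow> sform" where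
  "is_elementary_submodel M N = (is_subset M N \<^bold>\<and>
     (\<^bold>\<forall>n c s. is_natural n \<^bold>\<and> is_formula c n \<^bold>\<and> is_function_into s n M \<^bold>\<longrightarrow>
        (satisfies M c s \<^bold>\<longleftrightarrow> satisfies N c s)))"

definition is_strongly_extendible :: "var \<Rightarrow> sform" where
  "is_strongly_extendible M = (is_model M \<^bold>\<and>
     (\<^bold>\<forall>x. \<^bold>\<exists>N. x \<^bold>\<in> N \<^bold>\<and> is_model N \<^bold>\<and> is_elementary_submodel M N))"

definition Loc_sext_ZFC :: fm where
  "Loc_sext_ZFC = (\<^bold>\<forall>x. \<^bold>\<exists>M. x \<^bold>\<in> M \<^bold>\<and> is_strongly_extendible M) 0"

definition LZFC_sext :: "fm set" where
  "LZFC_sext = BST \<union> {Loc_sext_ZFC}"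

end

theory Submission
  imports Defs "HOL-Library.Countable_Set"
begin

text \<open>The calculus is complete, so both claims can be verified in an arbitrary structure \<open>(U, \<in>)\<close>
  satisfying the axioms. Formulas and their codes inside \<open>U\<close> may be nonstandard, but only codes of
  actual formulas matter, and on these every satisfaction set of \<open>U\<close> agrees with true satisfaction;
  hence \<open>M \<prec> N\<close> in the sense of \<open>U\<close> implies \<open>M \<prec> N\<close>.

  Powerset: let \<open>x \<in> M\<close> with \<open>M\<close> strongly extendible and let \<open>p\<close> be the power set of \<open>x\<close> in \<open>M\<close>. Every
  \<open>y \<subseteq> x\<close> lies in some \<open>N \<succ> M\<close>, and \<open>p\<close> is also the power set of \<open>x\<close> in \<open>N\<close>, so \<open>y \<in> p\<close>.

  Collection: let \<open>a\<close> and the parameters lie in a strongly extendible \<open>M\<close>. For \<open>x \<in> a\<close>, the witnesses of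
  a \<open>\<Sigma>\<^sub>1\<close> formula lie in some \<open>N \<succ> M\<close>; by elementarity there are witnesses in \<open>M\<close>, so \<open>M\<close> itself is a
  collecting set.\<close>

section \<open>Renaming and semantics\<close>

text \<open>The domain is an explicit set, so that one notion covers truth in the whole structure
  (\<open>UNIV\<close>) and truth in the extension of an element \<open>M\<close>. Assignments are
  total, as for de Bruijn indices there is no natural cut-off.\<close>

primrec sat :: "'a set \<Rightarrow> ('a \<Rightarrow> 'a \<Rightarrow> bool) \<Rightarrow> (nat \<Rightarrow> 'a) \<Rightarrow> fm \<Rightarrow> bool" where
  "sat D E e (Mem i j) = E (e i) (e j)"
| "sat D E e (Equal i j) = (e i = e j)"
| "sat D E e Fls = False"
| "sat D E e (Imp p q) = (sat D E e p \<longrightarrow> sat D E e q)"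
| "sat D E e (Forall p) = (\<forall>x\<in>D. sat D E (case_nat x e) p)"

lemma sat_Neg [simp]: "sat D E e (Neg p) \<longleftrightarrow> \<not> sat D E e p"
  by (simp add: Neg_def)

lemma sat_And [simp]: "sat D E e (And p q) \<longleftrightarrow> sat D E e p \<and> sat D E e q"
  by (simp add: And_def)

lemma sat_Or [simp]: "sat D E e (Or p q) \<longleftrightarrow> sat D E e p \<or> sat D E e q"
  by (auto simp: Or_def)

lemma sat_Iff [simp]: "sat D E e (Iff p q) \<longleftrightarrow> (sat D E e p \<longleftrightarrow> sat D E e q)"
  by (auto simp: Iff_def)

lemma sat_Exists [simp]: "sat D E e (Exists p) \<longleftrightarrow> (\<exists>x\<in>D. sat D E (case_nat x e) p)"
  by (simp add: Exists_def)

lemma ren_cong: "(\<And>i. i < arity p \<Longrightarrow> f i = g i) \<Longrightarrow> ren f p = ren g p"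
proof (induction p arbitrary: f g)
  case (Imp p q)
  have "ren f p = ren g p" "ren f q = ren g q"
    by (rule Imp.IH, simp add: Imp.prems)+
  then show ?case by simp
next
  case (Forall p)
  have "ren (case_nat 0 (\<lambda>i. Suc (f i))) p = ren (case_nat 0 (\<lambda>i. Suc (g i))) p"
    by (rule Forall.IH) (auto split: nat.splits intro: Forall.prems)
  then show ?case by simp
qed auto

lemma ren_ren: "ren f (ren g p) = ren (\<lambda>i. f (g i)) p"
proof (induction p arbitrary: f g)
  case (Forall p)
  have "(\<lambda>i. case_nat 0 (\<lambda>i. Suc (f i)) (case_nat 0 (\<lambda>i. Suc (g i)) i))
    = case_nat 0 (\<lambda>i. Suc (f (g i)))"
    by (auto simp: fun_eq_iff split: nat.split)
  then show ?case using Forall.IH by simp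
qed auto

lemma ren_ident: "ren (\<lambda>i. i) p = p"
proof (induction p)
  case (Forall p)
  have "case_nat 0 (\<lambda>i. Suc i) = (\<lambda>i. i)"
    by (auto simp: fun_eq_iff split: nat.split)
  then show ?case using Forall by simp
qed auto

lemma sat_cong: "(\<And>i. i < arity p \<Longrightarrow> e i = e' i) \<Longrightarrow> sat D E e p \<longleftrightarrow> sat D E e' p"
proof (induction p arbitrary: e e')
  case (Imp p q)
  have "sat D E e p \<longleftrightarrow> sat D E e' p" "sat D E e q \<longleftrightarrow> sat D E e' q"
    by (rule Imp.IH, simp add: Imp.prems)+
  then show ?case by simp
next
  case (Forall p)
  have "sat D E (case_nat x e) p \<longleftrightarrow> sat D E (case_nat x e') p" for x
    by (rule Forall.IH) (auto split: nat.splits intro: Forall.prems)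
  then show ?case by simp
qed auto

lemma sat_ren: "sat D E e (ren f p) \<longleftrightarrow> sat D E (\<lambda>i. e (f i)) p"
proof (induction p arbitrary: e f)
  case (Forall p)
  have "(\<lambda>i. case_nat x e (case_nat 0 (\<lambda>i. Suc (f i)) i)) = case_nat x (\<lambda>i. e (f i))" for x
    by (auto simp: fun_eq_iff split: nat.split)
  then show ?case by (simp add: Forall)
qed auto

text \<open>Isomorphism invariance: quantifiers over \<open>range h\<close> become quantifiers over
  preimages, and injectivity preserves equality atoms.\<close>

lemma sat_image:
  assumes "inj h"
  shows "sat (range h) E (\<lambda>i. h (e i)) p \<longleftrightarrow> sat UNIV (\<lambda>x y. E (h x) (h y)) e p"
proof (induction p arbitrary: e)
  case (Equal i j)
  then show ?case using assms by (auto simp: inj_eq)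
next
  case (Forall p)
  have "case_nat (h x) (\<lambda>i. h (e i)) = (\<lambda>i. h (case_nat x e i))" for x
    by (auto simp: fun_eq_iff split: nat.split)
  then show ?case by (simp add: Forall)
qed auto

lemma sat_univ_closure:
  assumes "\<And>e. range e \<subseteq> D \<Longrightarrow> sat D E e (univ_closure p)" "range e \<subseteq> D"
  shows "sat D E e p"
proof -
  have "(\<And>e. range e \<subseteq> D \<Longrightarrow> sat D E e ((Forall ^^ n) p)) \<Longrightarrow> range e \<subseteq> D \<Longrightarrow> sat D E e p" for n e
  proof (induction n arbitrary: e)
    case (Suc n)
    show ?case
    proof (rule Suc.IH[OF _ Suc.prems(2)])
      fix e :: "nat \<Rightarrow> 'a"
      assume e: "range e \<subseteq> D"
      then have "range (\<lambda>i. e (Suc i)) \<subseteq> D" "e 0 \<in> D" by auto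
      then have "sat D E (case_nat (e 0) (\<lambda>i. e (Suc i))) ((Forall ^^ n) p)"
        using Suc.prems(1) by fastforce
      moreover have "case_nat (e 0) (\<lambda>i. e (Suc i)) = e"
        by (auto simp: fun_eq_iff split: nat.split)
      ultimately show "sat D E e ((Forall ^^ n) p)" by simp
    qed
  qed auto
  then show ?thesis using assms unfolding univ_closure_def by blast
qed

section \<open>Completeness of the Hilbert calculus\<close>

lemma provable_Forall_pow: "T \<turnstile> p \<Longrightarrow> T \<turnstile> (Forall ^^ n) p"
  by (induction n) (auto intro: Gen)

text \<open>The axioms in \<open>T\<close> need not be sentences: a renaming is obtained by generalizing over all
  free variables and instantiating them one by one.\<close>

lemma provable_ren:
  assumes "T \<turnstile> p"
  shows "T \<turnstile> ren f p"
proof -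
  \<comment> \<open>The renaming obtained is controlled only on the \<open>n\<close> generalized
    indices; taking \<open>n\<close> to be the arity makes this enough.\<close>
  have *: "T \<turnstile> (Forall ^^ n) p \<Longrightarrow> \<exists>g. (\<forall>i<n. g i = f i) \<and> T \<turnstile> ren g p" for n f p
  proof (induction n arbitrary: p f)
    case 0
    then show ?case by (auto intro!: exI[of _ "\<lambda>i. i"] simp: ren_ident)
  next
    case (Suc n)
    then have "T \<turnstile> (Forall ^^ n) (Forall p)" by (simp add: funpow_swap1)
    from Suc.IH[OF this, of "\<lambda>i. f (Suc i)"]
    obtain g where g: "\<forall>i<n. g i = f (Suc i)" "T \<turnstile> ren g (Forall p)" by blast
    let ?g = "case_nat (f 0) g"
    have "T \<turnstile> inst (f 0) (ren (case_nat 0 (\<lambda>i. Suc (g i))) p)"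
      using g(2) by (auto intro: MP All_inst)
    moreover have "(\<lambda>i. case_nat (f 0) (\<lambda>i. i) (case_nat 0 (\<lambda>i. Suc (g i)) i)) = ?g"
      by (auto simp: fun_eq_iff split: nat.split)
    ultimately have "T \<turnstile> ren ?g p"
      by (simp add: inst_def ren_ren)
    moreover have "\<forall>i<Suc n. ?g i = f i"
      using g(1) by (auto simp: fun_eq_iff split: nat.split)
    ultimately show ?case by blast
  qed
  obtain g where g: "\<forall>i<arity p. g i = f i" "T \<turnstile> ren g p"
    using *[OF provable_Forall_pow[OF assms]] by blast
  have "ren g p = ren f p" using g(1) by (intro ren_cong) simp
  then show ?thesis using g(2) by simp
qed

section \<open>Derivations from hypotheses and the deduction theorem\<close>

text \<open>Generalization enters only through theorems of \<open>T\<close>, never after a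
  hypothesis from \<open>G\<close> has been used. Free variables of \<open>G\<close> thus behave
  like constants, and the deduction theorem holds without side conditions.\<close>

inductive entails :: "fm set \<Rightarrow> fm set \<Rightarrow> fm \<Rightarrow> bool" for T G where
  entails_thm: "T \<turnstile> p \<Longrightarrow> entails T G p"
| entails_hyp: "p \<in> G \<Longrightarrow> entails T G p"
| entails_MP: "entails T G (Imp p q) \<Longrightarrow> entails T G p \<Longrightarrow> entails T G q"

lemma entails_empty: "entails T {} p \<Longrightarrow> T \<turnstile> p"
  by (induction rule: entails.induct) (simp, simp, erule MP)

lemma entails_mono: "entails T G p \<Longrightarrow> G \<subseteq> G' \<Longrightarrow> entails T G' p"
  by (induction rule: entails.induct)
    (erule entails_thm, metis entails_hyp subsetD, metis entails_MP)

lemma entails_finite: "entails T G p \<Longrightarrow> \<exists>F. finite F \<and> F \<subseteq> G \<and> entails T F p"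
proof (induction rule: entails.induct)
  case (entails_thm p)
  then show ?case by (auto intro!: exI[of _ "{}"] entails.entails_thm)
next
  case (entails_hyp p)
  then show ?case by (auto intro!: exI[of _ "{p}"] entails.entails_hyp)
next
  case (entails_MP p q)
  then obtain F F' where "finite F" "F \<subseteq> G" "entails T F (Imp p q)"
    "finite F'" "F' \<subseteq> G" "entails T F' p" by blast
  then have "entails T (F \<union> F') (Imp p q)" "entails T (F \<union> F') p"
    by (auto elim: entails_mono)
  then have "entails T (F \<union> F') q" by (rule entails.entails_MP)
  then show ?case
    using \<open>finite F\<close> \<open>finite F'\<close> \<open>F \<subseteq> G\<close> \<open>F' \<subseteq> G\<close> by (intro exI[of _ "F \<union> F'"]) simp
qed

lemma provable_self_imp: "T \<turnstile> Imp p p"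
  by (rule MP[OF MP[OF Prop_S Prop_K[of _ _ "Imp p p"]] Prop_K])

lemma entails_K: "entails T G q \<Longrightarrow> entails T G (Imp p q)"
  by (rule entails_MP[OF entails_thm[OF Prop_K]])

lemma deduction: "entails T (insert q G) p \<Longrightarrow> entails T G (Imp q p)"
proof (induction rule: entails.induct)
  case (entails_thm p)
  then show ?case by (intro entails_K entails.entails_thm)
next
  case (entails_hyp p)
  then show ?case
    by (cases "p = q") (auto intro: entails_K entails.entails_hyp entails.entails_thm provable_self_imp)
next
  case (entails_MP p r)
  then show ?case
    by (metis entails.entails_MP entails.entails_thm Prop_S)
qed

lemma entails_DN: "entails T (insert (Neg p) G) Fls \<Longrightarrow> entails T G p"
  by (metis Neg_def deduction entails_MP entails_thm Prop_DN)

lemma entails_Fls: "entails T G Fls \<Longrightarrow> entails T G p"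
  by (meson entails_DN entails_mono subset_insertI)

lemma entails_ren: "entails T G p \<Longrightarrow> entails T (ren f ` G) (ren f p)"
  by (induction rule: entails.induct)
    (erule entails_thm[OF provable_ren], erule entails_hyp[OF imageI], metis ren.simps(4) entails_MP)

text \<open>Lifting frees index 0 in the hypotheses: each hypothesis can be generalized vacuously,
  and \<open>All_dist\<close> carries the quantifier through modus ponens.\<close>

lemma entails_Forall:
  assumes "entails T (lift 0 ` G) p"
  shows "entails T G (Forall p)"
  using assms
proof (induction rule: entails.induct)
  case (entails_thm p)
  then show ?case by (auto intro: entails.entails_thm Gen)
next
  case (entails_hyp p)
  then show ?case
    using entails.entails_MP[OF entails.entails_thm[OF All_vacuous] entails.entails_hyp] by auto
next
  case (entails_MP p q)
  then show ?case
    by (metis entails.entails_MP entails.entails_thm All_dist)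
qed

text \<open>A variable \<open>t\<close> that is not free in \<open>G\<close> plays the role of a fresh constant.\<close>

lemma entails_fresh:
  assumes "entails T G (inst t p)" and fresh: "\<forall>g\<in>G. arity g \<le> t" "arity p \<le> Suc t"
  shows "entails T G (Forall p)"
proof (rule entails_Forall)
  let ?f = "\<lambda>i. if i = t then 0 else Suc i"
  have "entails T (ren ?f ` G) (ren ?f (inst t p))"
    by (rule entails_ren[OF assms(1)])
  moreover have "ren ?f g = lift 0 g" if "g \<in> G" for g
    unfolding lift_def using fresh(1) that by (intro ren_cong) auto
  then have "ren ?f ` G = lift 0 ` G" by (intro image_cong) auto
  moreover have "ren ?f (inst t p) = ren (\<lambda>i. i) p"
    unfolding inst_def ren_ren using fresh(2) by (intro ren_cong) (auto simp: fun_eq_iff split: nat.split)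
  ultimately show "entails T (lift 0 ` G) p" by (simp add: ren_ident)
qed

section \<open>Henkin extensions of consistent sets\<close>

instance fm :: countable
  by countable_datatype

definition consistent :: "fm set \<Rightarrow> fm set \<Rightarrow> bool" where
  "consistent T G \<longleftrightarrow> \<not> entails T G Fls"

text \<open>As \<open>G\<close> is finite, some variable \<open>t\<close> lies beyond all free
  variables of \<open>G\<close> and \<open>p\<close>. Refuting \<open>Neg (inst t p)\<close> would
  then prove \<open>Forall p\<close>, contradicting its negation in \<open>G\<close>.\<close>

lemma consistent_witness:
  assumes "consistent T G" "finite G"
  shows "\<exists>t. Neg (Forall p) \<in> G \<longrightarrow> consistent T (insert (Neg (inst t p)) G)"
proof -
  define t where "t = Max (arity ` insert p G)"
  have t: "\<forall>g\<in>G. arity g \<le> t" "arity p \<le> Suc t"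
    unfolding t_def using assms(2) by (auto intro: le_SucI)
  have "consistent T (insert (Neg (inst t p)) G)" if "Neg (Forall p) \<in> G"
  proof (rule ccontr)
    assume "\<not> ?thesis"
    then have "entails T G (Forall p)"
      unfolding consistent_def using t by (metis entails_fresh entails_DN)
    moreover have "entails T G (Imp (Forall p) Fls)"
      using that by (auto intro: entails_hyp simp: Neg_def)
    ultimately show False
      using assms(1) by (metis consistent_def entails_MP)
  qed
  then show ?thesis by blast
qed

lemma henkin_step:
  assumes "consistent T G" "finite G"
  shows "\<exists>G'. G \<subseteq> G' \<and> finite G' \<and> consistent T G' \<and> (q \<in> G' \<or> Neg q \<in> G') \<and>
    (\<forall>p. Neg (Forall p) = q \<and> q \<in> G' \<longrightarrow> (\<exists>t. Neg (inst t p) \<in> G'))"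
proof (cases "consistent T (insert q G)")
  case True
  show ?thesis
  proof (cases "\<exists>p. q = Neg (Forall p)")
    case True
    then obtain p where p: "q = Neg (Forall p)" by blast
    obtain t where "consistent T (insert (Neg (inst t p)) (insert q G))"
      using consistent_witness[OF \<open>consistent T (insert q G)\<close>, of p] assms(2) p by auto
    then show ?thesis
      using assms(2) p by (intro exI[of _ "insert (Neg (inst t p)) (insert q G)"])
        (auto simp: Neg_def)
  next
    case False
    then show ?thesis using assms(2) True by (intro exI[of _ "insert q G"]) auto
  qed
next
  case False
  then have *: "entails T G (Neg q)"
    by (auto simp: consistent_def Neg_def intro: deduction)
  have "consistent T (insert (Neg q) G)"
  proof (rule ccontr)
    assume "\<not> ?thesis"
    then have "entails T G (Imp (Neg q) Fls)" by (auto simp: consistent_def intro: deduction)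
    then show False using * assms(1) by (metis consistent_def entails_MP)
  qed
  \<comment> \<open>Were \<open>q\<close> in \<open>G\<close>, then \<open>insert q G\<close> would
    be \<open>G\<close>, which is consistent. So the witness condition holds vacuously here.\<close>
  moreover have "q \<notin> insert (Neg q) G"
    using False assms(1) by (auto simp: insert_absorb Neg_def)
  ultimately show ?thesis using assms(2) by (intro exI[of _ "insert (Neg q) G"]) auto
qed

lemma henkin_extension:
  assumes "consistent T {p}"
  shows "\<exists>H. p \<in> H \<and> consistent T H \<and> (\<forall>q. q \<in> H \<or> Neg q \<in> H) \<and>
    (\<forall>q. Neg (Forall q) \<in> H \<longrightarrow> (\<exists>t. Neg (inst t q) \<in> H))"
proof -
  define step where "step q G G' \<longleftrightarrow> G \<subseteq> G' \<and> finite G' \<and> consistent T G' \<and> (q \<in> G' \<or> Neg q \<in> G') \<and>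
    (\<forall>p. Neg (Forall p) = q \<and> q \<in> G' \<longrightarrow> (\<exists>t. Neg (inst t p) \<in> G'))" for q G G'
  \<comment> \<open>Stage \<open>n\<close> decides the formula numbered \<open>n\<close>. Every
    stage stays finite, which leaves fresh variables for later witnesses.\<close>
  define S where "S = rec_nat {p} (\<lambda>n G. SOME G'. step (from_nat n) G G')"
  have S_Suc: "S (Suc n) = (SOME G'. step (from_nat n) (S n) G')" for n
    by (simp add: S_def)
  have ex_step: "\<exists>G'. step q G G'" if "consistent T G" "finite G" for q G
    unfolding step_def using that by (rule henkin_step)
  have S: "consistent T (S n) \<and> finite (S n)" for n
  proof (induction n)
    case 0
    show ?case using assms by (simp add: S_def)
  next
    case (Suc n)
    then have "step (from_nat n) (S n) (S (Suc n))"
      unfolding S_Suc using someI_ex[OF ex_step] by blast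
    then show ?case by (simp add: step_def)
  qed
  have step: "step (from_nat n) (S n) (S (Suc n))" for n
    unfolding S_Suc using S[of n] someI_ex[OF ex_step] by blast
  then have "S n \<subseteq> S (Suc n)" for n by (simp add: step_def)
  then have mono: "mono S" by (simp add: mono_iff_le_Suc)
  define H where "H = (\<Union>n. S n)"
  have "p \<in> S 0" by (simp add: S_def)
  then have "p \<in> H" unfolding H_def by blast
  moreover have "consistent T H"
  proof (rule ccontr)
    assume "\<not> consistent T H"
    then have "entails T H Fls" by (simp add: consistent_def)
    from entails_finite[OF this]
    obtain F where F: "finite F" "F \<subseteq> H" "entails T F Fls" by blast
    \<comment> \<open>A derivation of falsity uses finitely many hypotheses, and these already occur
      together in one stage of the increasing chain.\<close>
    have "F \<subseteq> H \<Longrightarrow> \<exists>n. F \<subseteq> S n"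
      using \<open>finite F\<close>
    proof (induction F)
      case (insert x F)
      then obtain n m where "F \<subseteq> S n" "x \<in> S m" unfolding H_def by blast
      then have "insert x F \<subseteq> S (max n m)"
        using monoD[OF mono, of n "max n m"] monoD[OF mono, of m "max n m"] by auto
      then show ?case by blast
    qed auto
    then obtain n where "F \<subseteq> S n" using F(2) by blast
    from entails_mono[OF F(3) this] show False using S[of n] by (simp add: consistent_def)
  qed
  moreover have "q \<in> H \<or> Neg q \<in> H" for q
    using step[of "to_nat q"] unfolding step_def H_def by auto
  moreover have "\<exists>t. Neg (inst t q) \<in> H" if "Neg (Forall q) \<in> H" for q
  proof -
    \<comment> \<open>The stage deciding this formula must have accepted it, since otherwise its
      negation would be in \<open>H\<close> too; acceptance brought a witness along.\<close>
    let ?n = "to_nat (Neg (Forall q))"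
    have "Neg (Forall q) \<in> S (Suc ?n)"
    proof (rule ccontr)
      assume "Neg (Forall q) \<notin> S (Suc ?n)"
      then have "Neg (Neg (Forall q)) \<in> S (Suc ?n)"
        using step[of ?n] unfolding step_def by auto
      then have "entails T H (Imp (Neg (Forall q)) Fls)"
        by (auto simp: Neg_def H_def intro!: entails_hyp)
      then show False
        using that \<open>consistent T H\<close> unfolding consistent_def by (metis entails_hyp entails_MP)
    qed
    then show ?thesis using step[of ?n] unfolding step_def H_def by fastforce
  qed
  ultimately show ?thesis by blast
qed

section \<open>Term model and the completeness theorem\<close>

text \<open>A Henkin set containing \<open>Neg p\<close> yields a countermodel. Variables are the
  only terms, so its elements are classes of variable indices, that is, sets of naturals; this
  explains the type of \<open>D\<close>.\<close>

lemma completeness: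
  assumes valid: "\<And>(D :: nat set set) E e.
      countable D \<Longrightarrow> range e \<subseteq> D \<Longrightarrow>
      (\<And>q e. q \<in> T \<Longrightarrow> range e \<subseteq> D \<Longrightarrow> sat D E e q) \<Longrightarrow> sat D E e p"
  shows "T \<turnstile> p"
proof (rule ccontr)
  assume not: "\<not> T \<turnstile> p"
  have "consistent T {Neg p}"
    unfolding consistent_def using not entails_DN entails_empty by blast
  then obtain H where H: "Neg p \<in> H" "consistent T H" "\<And>q. q \<in> H \<or> Neg q \<in> H"
    and witness: "\<And>q. Neg (Forall q) \<in> H \<Longrightarrow> \<exists>t. Neg (inst t q) \<in> H"
    using henkin_extension by blast
  have Neg: "Neg q \<in> H \<longleftrightarrow> q \<notin> H" for q
    using H(2,3) unfolding consistent_def Neg_def by (meson entails_MP entails_hyp)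
  have closed: "q \<in> H" if "entails T H q" for q
  proof (rule ccontr)
    assume "q \<notin> H"
    then have "entails T H (Imp q Fls)" using Neg entails_hyp unfolding Neg_def by blast
    then show False using that H(2) unfolding consistent_def by (metis entails_MP)
  qed
  have theorem_mem: "q \<in> H" if "T \<turnstile> q" for q
    using closed that by (blast intro: entails_thm)
  have mp: "q \<in> H" if "Imp r q \<in> H" "r \<in> H" for q r
    using closed that by (metis entails_hyp entails_MP)
  have Imp_iff: "Imp q r \<in> H \<longleftrightarrow> (q \<in> H \<longrightarrow> r \<in> H)" for q r
  proof
    assume "q \<in> H \<longrightarrow> r \<in> H"
    then consider "r \<in> H" | "Neg q \<in> H" using Neg by blast
    then show "Imp q r \<in> H"
    proof cases
      case 1
      then show ?thesis using closed by (metis entails_K entails_hyp)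
    next
      case 2
      then have "entails T (insert q H) Fls"
        unfolding Neg_def by (metis entails_hyp entails_MP insertCI)
      then show ?thesis using closed by (metis deduction entails_Fls)
    qed
  qed (blast intro: mp)
  have Forall_iff: "Forall q \<in> H \<longleftrightarrow> (\<forall>t. inst t q \<in> H)" for q
    using mp[OF theorem_mem[OF All_inst]] witness Neg by blast
  have subst: "Equal i j \<in> H \<Longrightarrow> inst i q \<in> H \<Longrightarrow> inst j q \<in> H" for i j q
    using mp[OF mp[OF theorem_mem[OF Eq_subst]]] by blast
  have refl: "Equal i i \<in> H" for i using theorem_mem Eq_refl by blast
  \<comment> \<open>Leibniz's law for a formula with index 0 as the place to be substituted;
    \<open>Suc i\<close> becomes the variable \<open>i\<close> after \<open>inst\<close>.\<close>
  have sym: "Equal j i \<in> H" if "Equal i j \<in> H" for i j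
    using subst[OF that, of "Equal 0 (Suc i)"] refl by (simp add: inst_def)
  have trans: "Equal i k \<in> H" if "Equal i j \<in> H" "Equal j k \<in> H" for i j k
    using subst[OF that(2), of "Equal (Suc i) 0"] that by (simp add: inst_def)
  have Mem: "Mem i' j' \<in> H" if "Mem i j \<in> H" "Equal i i' \<in> H" "Equal j j' \<in> H" for i j i' j'
    using subst[OF that(2), of "Mem 0 (Suc j)"] subst[OF that(3), of "Mem (Suc i') 0"] that(1)
    by (simp add: inst_def)
  define cls where "cls i = {j. Equal i j \<in> H}" for i
  have cls_eq: "cls i = cls j \<longleftrightarrow> Equal i j \<in> H" for i j
    unfolding cls_def using refl sym trans by blast
  define E where "E A B \<longleftrightarrow> (\<exists>i j. A = cls i \<and> B = cls j \<and> Mem i j \<in> H)" for A B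
  have E_cls: "E (cls i) (cls j) \<longleftrightarrow> Mem i j \<in> H" for i j
    unfolding E_def cls_eq using Mem refl sym by blast
  \<comment> \<open>Truth lemma, stated for all renamings \<open>f\<close>: an instance of the
    renamed body of a quantifier is again a renaming of that body, so the induction hypothesis
    applies.\<close>
  have truth: "sat (range cls) E (\<lambda>i. cls (f i)) q \<longleftrightarrow> ren f q \<in> H" for f q
  proof (induction q arbitrary: f)
    case Fls
    show ?case using H(2) by (auto simp: consistent_def intro: entails_hyp)
  next
    case (Forall q)
    have "case_nat (cls t) (\<lambda>i. cls (f i)) = (\<lambda>i. cls (case_nat t f i))" for t
      by (auto simp: fun_eq_iff split: nat.split)
    moreover have "inst t (ren (case_nat 0 (\<lambda>i. Suc (f i))) q) = ren (case_nat t f) q" for t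
    proof -
      have "(\<lambda>i. case_nat t (\<lambda>i. i) (case_nat 0 (\<lambda>i. Suc (f i)) i)) = case_nat t f"
        by (auto simp: fun_eq_iff split: nat.split)
      then show ?thesis by (simp add: inst_def ren_ren)
    qed
    ultimately show ?case by (simp add: Forall Forall_iff)
  qed (auto simp: E_cls cls_eq Imp_iff)
  \<comment> \<open>Choosing representatives turns an assignment into a renaming, and theorems of
    \<open>T\<close> are closed under renaming.\<close>
  have "sat (range cls) E e q" if q: "q \<in> T" and e: "range e \<subseteq> range cls" for q e
  proof -
    have "\<forall>i. \<exists>j. e i = cls j" using e by blast
    then obtain f where "\<forall>i. e i = cls (f i)" by metis
    then have "e = (\<lambda>i. cls (f i))" by blast
    moreover have "ren f q \<in> H" by (intro theorem_mem provable_ren Axiom q)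
    ultimately show ?thesis by (simp add: truth)
  qed
  then have "sat (range cls) E cls p" using valid[of "range cls" cls E] by auto
  then have "p \<in> H" using truth[of "\<lambda>i. i" p] by (simp add: ren_ident)
  then show False using H(1) Neg by blast
qed

section \<open>Models of the theory\<close>

lemma LZFC_sext_separation:
  assumes "\<And>q e. q \<in> LZFC_sext \<Longrightarrow> range e \<subseteq> D \<Longrightarrow> sat D E e q" "delta0 p" "range e \<subseteq> D"
  shows "sat D E e (separation p)"
proof (rule sat_univ_closure[OF _ assms(3)])
  show "sat D E e (univ_closure (separation p))" if "range e \<subseteq> D" for e
    using assms(1)[OF _ that] assms(2) by (auto simp: LZFC_sext_def BST_def)
qed

lemmas s_defs = s_mem_def s_eq_def s_not_def s_and_def s_or_def s_imp_def s_iff_def s_all_def s_ex_def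

text \<open>A finite model would contain, by pairing and union, a set of which every set is a member,
  against Russell's paradox.\<close>

lemma LZFC_sext_infinite:
  assumes "D \<noteq> {}" and ax: "\<And>q e. q \<in> LZFC_sext \<Longrightarrow> range e \<subseteq> D \<Longrightarrow> sat D E e q"
  shows "infinite D"
proof
  assume "finite D"
  obtain x0 where x0: "x0 \<in> D" using assms(1) by blast
  then have r: "range (\<lambda>_::nat. x0) \<subseteq> D" by auto
  have "sat D E (\<lambda>_. x0) pairing" by (rule ax[OF _ r]) (simp add: LZFC_sext_def BST_def)
  then have pair: "\<exists>z\<in>D. \<forall>u\<in>D. E u z \<longleftrightarrow> u = x \<or> u = y" if "x \<in> D" "y \<in> D" for x y
    using that by (simp add: pairing_def is_upair_def s_defs)
  have "sat D E (\<lambda>_. x0) union" by (rule ax[OF _ r]) (simp add: LZFC_sext_def BST_def)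
  then have union: "\<exists>u\<in>D. \<forall>z\<in>D. E z u \<longleftrightarrow> (\<exists>y\<in>D. E y x \<and> E z y)" if "x \<in> D" for x
    using that by (simp add: union_def is_union_def s_defs)
  have "delta0 (Neg (Mem 0 0))"
    unfolding Neg_def by (intro delta0.intros)
  from LZFC_sext_separation[OF ax this r]
  have sep: "\<exists>b\<in>D. \<forall>x\<in>D. E x b \<longleftrightarrow> E x a \<and> \<not> E x x" if "a \<in> D" for a
    using that by (simp add: separation_def lift_def Neg_def eval_nat_numeral)
  \<comment> \<open>Elements are added one at a time: \<open>t\<close> is the union of
    \<open>{u, {x}}\<close>. For \<open>F = D\<close> this gives the universal set.\<close>
  have "\<exists>u\<in>D. \<forall>x\<in>F. E x u" if "finite F" "F \<subseteq> D" for F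
    using that
  proof (induction F)
    case empty
    then show ?case using x0 by blast
  next
    case (insert x F)
    then obtain u where u: "u \<in> D" "\<forall>x\<in>F. E x u" by blast
    obtain y where y: "y \<in> D" "\<forall>z\<in>D. E z y \<longleftrightarrow> z = x" using pair[of x x] insert by auto
    obtain w where w: "w \<in> D" "\<forall>z\<in>D. E z w \<longleftrightarrow> z = u \<or> z = y" using pair u y by blast
    obtain t where t: "t \<in> D" "\<forall>z\<in>D. E z t \<longleftrightarrow> (\<exists>y\<in>D. E y w \<and> E z y)" using union w by blast
    have "\<forall>z\<in>insert x F. E z t"
      using u y w t insert.prems by (metis insertE insert_subset subsetD)
    then show ?case using t(1) by blast
  qed
  from this[OF \<open>finite D\<close>] obtain u where "u \<in> D" "\<forall>x\<in>D. E x u" by blast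
  then show False using sep by blast
qed

text \<open>A countably infinite domain can be transported to all of \<^typ>\<open>nat\<close>, so no relativization to a
  carrier is needed.\<close>

lemma LZFC_sext_completeness:
  assumes valid: "\<And>(E :: nat \<Rightarrow> nat \<Rightarrow> bool) e. (\<And>q e. q \<in> LZFC_sext \<Longrightarrow> sat UNIV E e q) \<Longrightarrow> sat UNIV E e p"
  shows "LZFC_sext \<turnstile> p"
proof (rule completeness)
  fix D :: "nat set set" and E and e :: "nat \<Rightarrow> nat set"
  assume D: "countable D" "range e \<subseteq> D"
    and ax: "\<And>q e. q \<in> LZFC_sext \<Longrightarrow> range e \<subseteq> D \<Longrightarrow> sat D E e q"
  have "infinite D" using D by (intro LZFC_sext_infinite[OF _ ax]) auto
  then have bij: "bij_betw (from_nat_into D) UNIV D"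
    using D bij_betw_from_nat_into by blast
  define h where "h = from_nat_into D"
  have h: "inj h" "range h = D" using bij by (auto simp: bij_betw_def h_def)
  have "\<forall>i. \<exists>j. e i = h j" using D(2) h(2) by blast
  then obtain f where "\<forall>i. e i = h (f i)" by metis
  then have e: "e = (\<lambda>i. h (f i))" by blast
  have "sat UNIV (\<lambda>x y. E (h x) (h y)) f p"
  proof (rule valid)
    fix q e
    assume "q \<in> LZFC_sext"
    then have "sat D E (\<lambda>i. h (e i)) q" using h(2) by (intro ax) auto
    then show "sat UNIV (\<lambda>x y. E (h x) (h y)) e q"
      using sat_image[OF h(1), of E e q] h(2) by simp
  qed
  then show "sat D E e p" using sat_image[OF h(1), of E f p] h(2) e by simp
qed

section \<open>Evaluation of formulas with named variables\<close>

text \<open>Indices beyond the depth \<open>d\<close> are given a fixed junk value; this makes the equations for the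
  quantifiers unconditional.\<close>

definition holds :: "('a \<Rightarrow> 'a \<Rightarrow> bool) \<Rightarrow> nat \<Rightarrow> (var \<Rightarrow> 'a) \<Rightarrow> sform \<Rightarrow> bool" where
  "holds E d v P = sat UNIV E (\<lambda>i. if i < d then v (d - Suc i) else undefined) (P d)"

lemma holds_mem [simp]: "x < d \<Longrightarrow> y < d \<Longrightarrow> holds E d v (x \<^bold>\<in> y) \<longleftrightarrow> E (v x) (v y)"
  by (simp add: holds_def s_mem_def)

lemma holds_eq [simp]: "x < d \<Longrightarrow> y < d \<Longrightarrow> holds E d v (x \<^bold>= y) \<longleftrightarrow> v x = v y"
  by (simp add: holds_def s_eq_def)

lemma holds_not [simp]: "holds E d v (\<^bold>\<not> P) \<longleftrightarrow> \<not> holds E d v P"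
  by (simp add: holds_def s_not_def)

lemma holds_and [simp]: "holds E d v (P \<^bold>\<and> Q) \<longleftrightarrow> holds E d v P \<and> holds E d v Q"
  by (simp add: holds_def s_and_def)

lemma holds_or [simp]: "holds E d v (P \<^bold>\<or> Q) \<longleftrightarrow> holds E d v P \<or> holds E d v Q"
  by (simp add: holds_def s_or_def)

lemma holds_imp [simp]: "holds E d v (P \<^bold>\<longrightarrow> Q) \<longleftrightarrow> (holds E d v P \<longrightarrow> holds E d v Q)"
  by (simp add: holds_def s_imp_def)

lemma holds_iff [simp]: "holds E d v (P \<^bold>\<longleftrightarrow> Q) \<longleftrightarrow> (holds E d v P \<longleftrightarrow> holds E d v Q)"
  by (simp add: holds_def s_iff_def)

text \<open>The variable of a new innermost quantifier has index 0 and level \<open>d\<close>, so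
  shifting indices amounts to updating level \<open>d\<close>.\<close>

lemma level_env_Suc:
  "case_nat a (\<lambda>i. if i < d then v (d - Suc i) else undefined) =
   (\<lambda>i. if i < Suc d then (v(d := a)) (Suc d - Suc i) else undefined)"
  by (auto simp: fun_eq_iff split: nat.split)

lemma holds_all [simp]: "holds E d v (s_all P) \<longleftrightarrow> (\<forall>a. holds E (Suc d) (v(d := a)) (P d))"
  unfolding holds_def s_all_def by (simp add: level_env_Suc)

lemma holds_ex [simp]: "holds E d v (s_ex P) \<longleftrightarrow> (\<exists>a. holds E (Suc d) (v(d := a)) (P d))"
  unfolding holds_def s_ex_def by (simp add: level_env_Suc)

section \<open>Set theory inside a model\<close>

locale LZFC_sext_model =
  fixes E :: "'a \<Rightarrow> 'a \<Rightarrow> bool" (infix "\<epsilon>" 50)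
  assumes ax: "q \<in> LZFC_sext \<Longrightarrow> sat UNIV E e q"
begin

abbreviation H :: "nat \<Rightarrow> (var \<Rightarrow> 'a) \<Rightarrow> sform \<Rightarrow> bool" where
  "H \<equiv> holds E"

lemma ax_holds: "P 0 \<in> LZFC_sext \<Longrightarrow> H 0 v P"
  unfolding holds_def by (rule ax)

lemma ext: "(\<And>z. z \<epsilon> x \<longleftrightarrow> z \<epsilon> y) \<Longrightarrow> x = y"
proof -
  have "H 0 undefined (\<^bold>\<forall>x y. (\<^bold>\<forall>z. z \<^bold>\<in> x \<^bold>\<longleftrightarrow> z \<^bold>\<in> y) \<^bold>\<longrightarrow> x \<^bold>= y)"
    by (rule ax_holds) (simp add: LZFC_sext_def BST_def extensionality_def)
  then show "(\<And>z. z \<epsilon> x \<longleftrightarrow> z \<epsilon> y) \<Longrightarrow> x = y" by simp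
qed

lemma ex_upair: "\<exists>z. \<forall>u. u \<epsilon> z \<longleftrightarrow> u = x \<or> u = y"
proof -
  have "H 0 undefined (\<^bold>\<forall>x y. \<^bold>\<exists>z. is_upair z x y)"
    by (rule ax_holds) (simp add: LZFC_sext_def BST_def pairing_def)
  then show ?thesis by (simp add: is_upair_def)
qed

lemma ex_union: "\<exists>u. \<forall>z. z \<epsilon> u \<longleftrightarrow> (\<exists>y. y \<epsilon> x \<and> z \<epsilon> y)"
proof -
  have "H 0 undefined (\<^bold>\<forall>x. \<^bold>\<exists>u. is_union u x)"
    by (rule ax_holds) (simp add: LZFC_sext_def BST_def union_def)
  then show ?thesis by (simp add: is_union_def)
qed

lemma ex_empty: "\<exists>x. \<forall>z. \<not> z \<epsilon> x"
proof -
  have "H 0 undefined (\<^bold>\<exists>x. is_empty x)"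
    by (rule ax_holds) (simp add: LZFC_sext_def BST_def empty_set_def)
  then show ?thesis by (simp add: is_empty_def)
qed

section \<open>Finite sets, ordered pairs and standard numerals\<close>

lemma ex_finite_set: "finite F \<Longrightarrow> \<exists>u. \<forall>z. z \<epsilon> u \<longleftrightarrow> z \<in> F"
proof (induction F rule: finite_induct)
  case empty
  then show ?case using ex_empty by auto
next
  case (insert x F)
  then obtain u where u: "\<forall>z. z \<epsilon> u \<longleftrightarrow> z \<in> F" by blast
  obtain y where y: "\<forall>z. z \<epsilon> y \<longleftrightarrow> z = x" using ex_upair[of x x] by auto
  obtain w where w: "\<forall>z. z \<epsilon> w \<longleftrightarrow> z = u \<or> z = y" using ex_upair by blast
  obtain t where t: "\<forall>z. z \<epsilon> t \<longleftrightarrow> (\<exists>y. y \<epsilon> w \<and> z \<epsilon> y)" using ex_union by blast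
  show ?case using u y w t by (intro exI[of _ t]) auto
qed

definition fset :: "'a set \<Rightarrow> 'a" where
  "fset F = (THE u. \<forall>z. z \<epsilon> u \<longleftrightarrow> z \<in> F)"

lemma mem_fset [simp]: "finite F \<Longrightarrow> z \<epsilon> fset F \<longleftrightarrow> z \<in> F"
proof -
  assume "finite F"
  then obtain u where u: "\<forall>z. z \<epsilon> u \<longleftrightarrow> z \<in> F" using ex_finite_set by blast
  then have "fset F = u" unfolding fset_def by (intro the_equality) (auto intro: ext)
  then show ?thesis using u by simp
qed

lemma eq_fset_iff: "finite F \<Longrightarrow> x = fset F \<longleftrightarrow> (\<forall>z. z \<epsilon> x \<longleftrightarrow> z \<in> F)"
  by (auto intro: ext)

lemma fset_inject [simp]: "finite F \<Longrightarrow> finite G \<Longrightarrow> fset F = fset G \<longleftrightarrow> F = G"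
  by (metis mem_fset set_eqI)

definition opair :: "'a \<Rightarrow> 'a \<Rightarrow> 'a" where
  "opair x y = fset {fset {x}, fset {x, y}}"

lemma opair_inject [simp]: "opair x y = opair x' y' \<longleftrightarrow> x = x' \<and> y = y'"
  by (auto simp: opair_def doubleton_eq_iff)

text \<open>The standard von Neumann numerals, indexed by the naturals of the metatheory; the
  structure may have further natural numbers.\<close>

primrec num :: "nat \<Rightarrow> 'a" where
  "num 0 = fset {}"
| "num (Suc k) = fset (insert (num k) {z. z \<epsilon> num k})"

text \<open>Finiteness is part of the induction because the elements of \<open>fset\<close> are
  known only for finite arguments.\<close>

lemma mem_num: "finite {z. z \<epsilon> num n} \<and> (\<forall>z. z \<epsilon> num n \<longleftrightarrow> (\<exists>i<n. z = num i))"
proof (induction n)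
  case (Suc n)
  then show ?case by (auto simp: less_Suc_eq)
qed simp

lemma mem_num_iff [simp]: "z \<epsilon> num n \<longleftrightarrow> (\<exists>i<n. z = num i)"
  using mem_num by blast

text \<open>Foundation is not an axiom of the theory, so induction is used: if
  \<open>num i = num (Suc n)\<close>, then \<open>num n\<close> is some \<open>num j\<close> with
  \<open>j < i\<close>, hence \<open>j < n\<close>.\<close>

lemma num_neq: "i < n \<Longrightarrow> num i \<noteq> num n"
proof (induction n arbitrary: i)
  case (Suc n)
  show ?case
  proof
    assume eq: "num i = num (Suc n)"
    have "num n \<epsilon> num (Suc n)" by (auto simp del: num.simps)
    then obtain j where "j < i" "num n = num j" using eq by (metis mem_num_iff)
    then show False using Suc by (metis less_Suc_eq not_less_eq order.strict_trans)
  qed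
qed simp

lemma num_inject [simp]: "num i = num j \<longleftrightarrow> i = j"
  by (metis num_neq nat_neq_iff)

declare num.simps [simp del]

definition Succ :: "'a \<Rightarrow> 'a \<Rightarrow> bool" where
  "Succ y x \<longleftrightarrow> (\<forall>u. u \<epsilon> y \<longleftrightarrow> u \<epsilon> x \<or> u = x)"

lemma Succ_num [simp]: "Succ y (num n) \<longleftrightarrow> y = num (Suc n)"
  unfolding Succ_def num.simps(2) using mem_num[of n] by (subst eq_fset_iff) auto

definition Inductive :: "'a \<Rightarrow> bool" where
  "Inductive w \<longleftrightarrow> num 0 \<epsilon> w \<and> (\<forall>x. x \<epsilon> w \<longrightarrow> (\<exists>y. Succ y x \<and> y \<epsilon> w))"

definition Natural :: "'a \<Rightarrow> bool" where
  "Natural n \<longleftrightarrow> (\<exists>w. Inductive w \<and> (\<forall>v. Inductive v \<longrightarrow> (\<forall>z. z \<epsilon> w \<longrightarrow> z \<epsilon> v)) \<and> n \<epsilon> w)"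

section \<open>Meaning of the basic vocabulary in the structure\<close>

lemma holds_empty [simp]: "x < d \<Longrightarrow> H d v (is_empty x) \<longleftrightarrow> v x = num 0"
  by (simp add: is_empty_def eq_fset_iff num.simps)

lemma holds_subset [simp]:
  "x < d \<Longrightarrow> y < d \<Longrightarrow> H d v (is_subset x y) \<longleftrightarrow> (\<forall>z. z \<epsilon> v x \<longrightarrow> z \<epsilon> v y)"
  by (simp add: is_subset_def)

lemma holds_upair [simp]:
  "z < d \<Longrightarrow> x < d \<Longrightarrow> y < d \<Longrightarrow> H d v (is_upair z x y) \<longleftrightarrow> v z = fset {v x, v y}"
  by (simp add: is_upair_def eq_fset_iff)

lemma holds_pair [simp]:
  "p < d \<Longrightarrow> x < d \<Longrightarrow> y < d \<Longrightarrow> H d v (is_pair p x y) \<longleftrightarrow> v p = opair (v x) (v y)"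
  by (simp add: is_pair_def opair_def)

lemma holds_succ [simp]: "y < d \<Longrightarrow> x < d \<Longrightarrow> H d v (is_succ y x) \<longleftrightarrow> Succ (v y) (v x)"
  by (simp add: is_succ_def Succ_def)

lemma holds_inductive [simp]: "w < d \<Longrightarrow> H d v (is_inductive w) \<longleftrightarrow> Inductive (v w)"
  by (simp add: is_inductive_def Inductive_def)

lemma holds_natural [simp]: "n < d \<Longrightarrow> H d v (is_natural n) \<longleftrightarrow> Natural (v n)"
  by (simp add: is_natural_def is_omega_def Natural_def)

lemma holds_numeral [simp]: "x < d \<Longrightarrow> H d v (is_numeral k x) \<longleftrightarrow> v x = num k"
  by (induction k arbitrary: x d v) simp_all

text \<open>By external induction every inductive set contains all standard numerals, in particular
  the \<omega> of the structure.\<close>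

lemma Natural_num [simp]: "Natural (num n)"
proof -
  have "H 0 undefined (\<^bold>\<exists>w. is_omega w)"
    by (rule ax_holds) (simp add: LZFC_sext_def BST_def omega_exists_def)
  then obtain w where w: "Inductive w" "\<forall>v. Inductive v \<longrightarrow> (\<forall>z. z \<epsilon> w \<longrightarrow> z \<epsilon> v)"
    by (auto simp: is_omega_def)
  have "num n \<epsilon> w"
    using w(1) by (induction n) (auto simp: Inductive_def)
  then show ?thesis using w unfolding Natural_def by blast
qed

lemma holds_transitive [simp]:
  "x < d \<Longrightarrow> H d v (is_transitive x) \<longleftrightarrow> (\<forall>y. y \<epsilon> v x \<longrightarrow> (\<forall>z. z \<epsilon> y \<longrightarrow> z \<epsilon> v x))"
  by (simp add: is_transitive_def)

lemma holds_apply [simp]: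
  "f < d \<Longrightarrow> x < d \<Longrightarrow> y < d \<Longrightarrow> H d v (is_apply f x y) \<longleftrightarrow> opair (v x) (v y) \<epsilon> v f"
  by (simp add: is_apply_def)

definition Fun :: "'a \<Rightarrow> 'a \<Rightarrow> bool" where
  "Fun f n \<longleftrightarrow> (\<forall>p. p \<epsilon> f \<longrightarrow> (\<exists>x y. x \<epsilon> n \<and> p = opair x y)) \<and>
    (\<forall>x. x \<epsilon> n \<longrightarrow> (\<exists>y. \<forall>z. opair x z \<epsilon> f \<longleftrightarrow> z = y))"

lemma holds_function [simp]: "f < d \<Longrightarrow> n < d \<Longrightarrow> H d v (is_function f n) \<longleftrightarrow> Fun (v f) (v n)"
  by (simp add: is_function_def Fun_def)

definition Into :: "'a \<Rightarrow> 'a \<Rightarrow> 'a \<Rightarrow> bool" where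
  "Into f n M \<longleftrightarrow> Fun f n \<and> (\<forall>x y. opair x y \<epsilon> f \<longrightarrow> y \<epsilon> M)"

lemma holds_function_into [simp]:
  "f < d \<Longrightarrow> n < d \<Longrightarrow> M < d \<Longrightarrow> H d v (is_function_into f n M) \<longleftrightarrow> Into (v f) (v n) (v M)"
  by (simp add: is_function_into_def Into_def)

section \<open>Finite sequences of standard length\<close>

text \<open>Links an internal function on a standard numeral to an initial segment of an external
  sequence; this translates between internal assignments and those of \<open>sat\<close>.\<close>

definition Seq :: "'a \<Rightarrow> nat \<Rightarrow> (nat \<Rightarrow> 'a) \<Rightarrow> bool" where
  "Seq s n e \<longleftrightarrow> Fun s (num n) \<and> (\<forall>i<n. opair (num i) (e i) \<epsilon> s)"

lemma Seq_apply:
  assumes "Seq s n e"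
  shows "opair x y \<epsilon> s \<longleftrightarrow> (\<exists>i<n. x = num i \<and> y = e i)"
proof
  assume *: "opair x y \<epsilon> s"
  then have "x \<epsilon> num n" using assms unfolding Seq_def Fun_def by (metis opair_inject)
  then obtain i where i: "i < n" "x = num i" by auto
  moreover have "opair (num i) (e i) \<epsilon> s" using assms i by (simp add: Seq_def)
  moreover obtain y0 where "\<forall>z. opair x z \<epsilon> s \<longleftrightarrow> z = y0"
    using assms \<open>x \<epsilon> num n\<close> unfolding Seq_def Fun_def by blast
  ultimately show "\<exists>i<n. x = num i \<and> y = e i" using * by metis
qed (use assms in \<open>auto simp: Seq_def\<close>)

lemma Seq_exists: "\<exists>s. Seq s n e"
proof
  show "Seq (fset ((\<lambda>i. opair (num i) (e i)) ` {..<n})) n e"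
    unfolding Seq_def Fun_def by auto
qed

lemma Seq_Into: "Seq s n e \<Longrightarrow> (\<And>i. e i \<epsilon> M) \<Longrightarrow> Into s (num n) M"
  unfolding Into_def by (auto simp: Seq_apply) (simp add: Seq_def)

section \<open>Codes of formulas\<close>

lemma holds_tagged [simp]:
  "c < d \<Longrightarrow> x < d \<Longrightarrow> H d v (is_tagged k c x) \<longleftrightarrow> v c = opair (num k) (v x)"
  by (simp add: is_tagged_def)

lemma holds_code_Mem [simp]:
  "c < d \<Longrightarrow> i < d \<Longrightarrow> j < d \<Longrightarrow>
    H d v (code_Mem c i j) \<longleftrightarrow> v c = opair (num 0) (opair (v i) (v j))"
  by (simp add: code_Mem_def)

lemma holds_code_Equal [simp]:
  "c < d \<Longrightarrow> i < d \<Longrightarrow> j < d \<Longrightarrow>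
    H d v (code_Equal c i j) \<longleftrightarrow> v c = opair (num 1) (opair (v i) (v j))"
  by (simp add: code_Equal_def)

lemma holds_code_Fls [simp]: "c < d \<Longrightarrow> H d v (code_Fls c) \<longleftrightarrow> v c = opair (num 2) (num 0)"
  by (simp add: code_Fls_def)

lemma holds_code_Imp [simp]:
  "c < d \<Longrightarrow> a < d \<Longrightarrow> b < d \<Longrightarrow>
    H d v (code_Imp c a b) \<longleftrightarrow> v c = opair (num 3) (opair (v a) (v b))"
  by (simp add: code_Imp_def)

lemma holds_code_Forall [simp]:
  "c < d \<Longrightarrow> a < d \<Longrightarrow> H d v (code_Forall c a) \<longleftrightarrow> v c = opair (num 4) (v a)"
  by (simp add: code_Forall_def)

primrec code :: "fm \<Rightarrow> 'a" where
  "code (Mem i j) = opair (num 0) (opair (num i) (num j))"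
| "code (Equal i j) = opair (num 1) (opair (num i) (num j))"
| "code Fls = opair (num 2) (num 0)"
| "code (Imp p q) = opair (num 3) (opair (code p) (code q))"
| "code (Forall p) = opair (num 4) (code p)"

lemma holds_quote [simp]: "c < d \<Longrightarrow> H d v (quote p c) \<longleftrightarrow> v c = code p"
  by (induction p arbitrary: c d v)
    (simp_all add: qMem_def qEqual_def qFls_def qImp_def qForall_def)

section \<open>Formation sequences of standard formulas\<close>

definition Formula_step :: "('a \<Rightarrow> bool) \<Rightarrow> 'a \<Rightarrow> bool" where
  "Formula_step P u \<longleftrightarrow> (\<exists>c n. u = opair c n \<and> Natural n \<and>
     ((\<exists>i j. i \<epsilon> n \<and> j \<epsilon> n \<and>
         (c = opair (num 0) (opair i j) \<or> c = opair (num 1) (opair i j))) \<or>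
      c = opair (num 2) (num 0) \<or>
      (\<exists>a b. c = opair (num 3) (opair a b) \<and> P (opair a n) \<and> P (opair b n)) \<or>
      (\<exists>a m. c = opair (num 4) a \<and> Succ m n \<and> P (opair a m))))"

definition Formula :: "'a \<Rightarrow> 'a \<Rightarrow> bool" where
  "Formula c n \<longleftrightarrow> (\<exists>l m f. Natural l \<and> Succ m l \<and> Fun f m \<and> opair l (opair c n) \<epsilon> f \<and>
     (\<forall>k u. opair k u \<epsilon> f \<longrightarrow> Formula_step (\<lambda>v. \<exists>j. j \<epsilon> k \<and> opair j v \<epsilon> f) u))"

lemma holds_formula [simp]:
  "c < d \<Longrightarrow> n < d \<Longrightarrow> H d v (is_formula c n) \<longleftrightarrow> Formula (v c) (v n)"
  unfolding is_formula_def is_constructed_def is_formula_step_def Formula_def Formula_step_def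
  by simp

text \<open>Formation sequences as external lists, which are easier to concatenate and extend than
  functions inside the structure.\<close>

definition construction :: "'a list \<Rightarrow> bool" where
  "construction zs \<longleftrightarrow> (\<forall>k<length zs. Formula_step (\<lambda>v. v \<in> set (take k zs)) (zs ! k))"

lemma Formula_step_mono: "Formula_step P u \<Longrightarrow> (\<And>v. P v \<Longrightarrow> Q v) \<Longrightarrow> Formula_step Q u"
  unfolding Formula_step_def by blast

text \<open>Entries of \<open>ys\<close> only gain predecessors, and \<open>Formula_step\<close> is
  monotone in the predicate for earlier entries.\<close>

lemma construction_append:
  assumes "construction xs" "construction ys"
  shows "construction (xs @ ys)"
  unfolding construction_def
proof (intro allI impI)
  fix k assume "k < length (xs @ ys)"
  show "Formula_step (\<lambda>v. v \<in> set (take k (xs @ ys))) ((xs @ ys) ! k)"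
  proof (cases "k < length xs")
    case True
    then show ?thesis using assms(1) by (simp add: construction_def nth_append)
  next
    case False
    then have "Formula_step (\<lambda>v. v \<in> set (take (k - length xs) ys)) (ys ! (k - length xs))"
      using assms(2) \<open>k < length (xs @ ys)\<close> by (simp add: construction_def)
    then show ?thesis using False by (auto simp: nth_append elim: Formula_step_mono)
  qed
qed

lemma construction_snoc:
  "construction xs \<Longrightarrow> Formula_step (\<lambda>v. v \<in> set xs) u \<Longrightarrow> construction (xs @ [u])"
  by (auto simp: construction_def nth_append less_Suc_eq)

text \<open>An external list becomes an internal function with domain
  \<open>num (Suc (length zs))\<close>, and \<open>num (length zs)\<close> is the index of its last
  entry.\<close>

lemma Formula_construction:
  assumes "construction (zs @ [opair c n])"
  shows "Formula c n"
proof -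
  let ?zs = "zs @ [opair c n]"
  obtain f where f: "Seq f (Suc (length zs)) (\<lambda>k. ?zs ! k)" using Seq_exists by blast
  have "Formula_step (\<lambda>v. \<exists>j. j \<epsilon> k \<and> opair j v \<epsilon> f) u" if ku: "opair k u \<epsilon> f" for k u
  proof -
    obtain i where i: "i < Suc (length zs)" "k = num i" "u = ?zs ! i"
      using ku Seq_apply[OF f] by auto
    then have "Formula_step (\<lambda>v. v \<in> set (take i ?zs)) u"
      using assms unfolding construction_def by simp
    then show ?thesis
    proof (rule Formula_step_mono)
      fix v assume "v \<in> set (take i ?zs)"
      then obtain j where "j < i" "v = ?zs ! j" by (auto simp: in_set_conv_nth simp del: take_append)
      then show "\<exists>j. j \<epsilon> k \<and> opair j v \<epsilon> f"
        using i by (intro exI[of _ "num j"]) (auto simp: Seq_apply[OF f])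
    qed
  qed
  moreover have "opair (num (length zs)) (opair c n) \<epsilon> f"
    by (auto simp: Seq_apply[OF f] intro!: exI[of _ "length zs"])
  moreover have "Fun f (num (Suc (length zs)))" using f by (simp add: Seq_def)
  ultimately show ?thesis
    unfolding Formula_def
    by (intro exI[of _ "num (length zs)"] exI[of _ "num (Suc (length zs))"] exI[of _ f]) auto
qed

text \<open>The bound \<open>n\<close> varies in the induction, since the body of a quantifier is
  built with bound \<open>Suc n\<close>. Implication concatenates the sequences of its two
  parts.\<close>

lemma construction_code: "arity p \<le> n \<Longrightarrow> \<exists>zs. construction (zs @ [opair (code p) (num n)])"
proof (induction p arbitrary: n)
  case (Mem i j)
  then show ?case
    by (intro exI[of _ "[]"]) (auto simp: construction_def Formula_step_def)
next
  case (Equal i j)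
  then show ?case
    by (intro exI[of _ "[]"]) (auto simp: construction_def Formula_step_def)
next
  case Fls
  then show ?case
    by (intro exI[of _ "[]"]) (auto simp: construction_def Formula_step_def)
next
  case (Imp p q)
  then obtain xs ys where "construction (xs @ [opair (code p) (num n)])"
    "construction (ys @ [opair (code q) (num n)])" by fastforce
  from construction_append[OF this] show ?case
    by (intro exI construction_snoc) (auto simp: Formula_step_def)
next
  case (Forall p)
  then obtain xs where "construction (xs @ [opair (code p) (num (Suc n))])"
    by (metis arity.simps(5) le_diff_conv Suc_eq_plus1)
  then show ?case
    by (intro exI construction_snoc) (auto simp: Formula_step_def)
qed

lemma Formula_code: "arity p \<le> n \<Longrightarrow> Formula (code p) (num n)"
  using construction_code Formula_construction by blast

section \<open>Satisfaction inside a model\<close>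

definition Prepend :: "'a \<Rightarrow> 'a \<Rightarrow> 'a \<Rightarrow> 'a \<Rightarrow> bool" where
  "Prepend t m x s \<longleftrightarrow> Fun t m \<and> opair (num 0) x \<epsilon> t \<and>
    (\<forall>i j y. opair i y \<epsilon> s \<and> Succ j i \<longrightarrow> opair j y \<epsilon> t)"

lemma holds_cons [simp]:
  "t < d \<Longrightarrow> m < d \<Longrightarrow> x < d \<Longrightarrow> s < d \<Longrightarrow>
    H d v (is_cons t m x s) \<longleftrightarrow> Prepend (v t) (v m) (v x) (v s)"
  by (simp add: is_cons_def Prepend_def)

text \<open>The domain of \<open>s\<close> is a standard numeral, so the internal shift of all its
  indices is a shift of finitely many standard ones.\<close>

lemma Prepend_iff_Seq:
  assumes "Seq s n e"
  shows "Prepend t (num (Suc n)) x s \<longleftrightarrow> Seq t (Suc n) (case_nat x e)"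
proof -
  have "(\<forall>i j y. opair i y \<epsilon> s \<and> Succ j i \<longrightarrow> opair j y \<epsilon> t) \<longleftrightarrow>
      (\<forall>k<n. opair (num (Suc k)) (e k) \<epsilon> t)"
    unfolding Seq_apply[OF assms] by (metis Succ_num)
  then show ?thesis by (auto simp: Prepend_def Seq_def less_Suc_eq_0_disj)
qed

definition Satisfaction :: "'a \<Rightarrow> 'a \<Rightarrow> bool" where
  "Satisfaction S M \<longleftrightarrow> (\<forall>n s. Natural n \<and> Into s n M \<longrightarrow>
     (\<forall>i j. i \<epsilon> n \<and> j \<epsilon> n \<longrightarrow> (opair (opair (num 0) (opair i j)) s \<epsilon> S \<longleftrightarrow>
        (\<exists>x y. opair i x \<epsilon> s \<and> opair j y \<epsilon> s \<and> x \<epsilon> y))) \<and>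
     (\<forall>i j. i \<epsilon> n \<and> j \<epsilon> n \<longrightarrow> (opair (opair (num 1) (opair i j)) s \<epsilon> S \<longleftrightarrow>
        (\<exists>x. opair i x \<epsilon> s \<and> opair j x \<epsilon> s))) \<and>
     \<not> opair (opair (num 2) (num 0)) s \<epsilon> S \<and>
     (\<forall>a b. Formula a n \<and> Formula b n \<longrightarrow> (opair (opair (num 3) (opair a b)) s \<epsilon> S \<longleftrightarrow>
        (opair a s \<epsilon> S \<longrightarrow> opair b s \<epsilon> S))) \<and>
     (\<forall>a m. Succ m n \<and> Formula a m \<longrightarrow> (opair (opair (num 4) a) s \<epsilon> S \<longleftrightarrow>
        (\<forall>x t. x \<epsilon> M \<and> Prepend t m x s \<longrightarrow> opair a t \<epsilon> S))))"

lemma holds_satisfaction [simp]: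
  "S < d \<Longrightarrow> M < d \<Longrightarrow> H d v (is_satisfaction S M) \<longleftrightarrow> Satisfaction (v S) (v M)"
  unfolding is_satisfaction_def sat_in_def Satisfaction_def by auto

lemma Satisfaction_clauses:
  assumes "Satisfaction S M" and s: "Seq s n e" and e: "\<And>i. e i \<epsilon> M"
  shows "i < n \<Longrightarrow> j < n \<Longrightarrow> opair (code (Mem i j)) s \<epsilon> S \<longleftrightarrow> e i \<epsilon> e j"
    and "i < n \<Longrightarrow> j < n \<Longrightarrow> opair (code (Equal i j)) s \<epsilon> S \<longleftrightarrow> e i = e j"
    and "\<not> opair (code Fls) s \<epsilon> S"
    and "arity p \<le> n \<Longrightarrow> arity q \<le> n \<Longrightarrow>
      opair (code (Imp p q)) s \<epsilon> S \<longleftrightarrow> (opair (code p) s \<epsilon> S \<longrightarrow> opair (code q) s \<epsilon> S)"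
    and "arity p \<le> Suc n \<Longrightarrow> opair (code (Forall p)) s \<epsilon> S \<longleftrightarrow>
      (\<forall>x t. x \<epsilon> M \<and> Seq t (Suc n) (case_nat x e) \<longrightarrow> opair (code p) t \<epsilon> S)"
proof -
  note sat = assms(1)[unfolded Satisfaction_def, THEN spec, THEN spec, of "num n" s,
      THEN mp, OF conjI[OF Natural_num Seq_Into[OF s e]]]
  show "opair (code (Mem i j)) s \<epsilon> S \<longleftrightarrow> e i \<epsilon> e j" if "i < n" "j < n"
    using sat[THEN conjunct1, THEN spec, THEN spec, of "num i" "num j"] that
    by (auto simp: Seq_apply[OF s])
  show "opair (code (Equal i j)) s \<epsilon> S \<longleftrightarrow> e i = e j" if "i < n" "j < n"
    using sat[THEN conjunct2, THEN conjunct1, THEN spec, THEN spec, of "num i" "num j"] that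
    by (auto simp: Seq_apply[OF s])
  show "\<not> opair (code Fls) s \<epsilon> S" using sat by simp
  show "opair (code (Imp p q)) s \<epsilon> S \<longleftrightarrow> (opair (code p) s \<epsilon> S \<longrightarrow> opair (code q) s \<epsilon> S)"
    if "arity p \<le> n" "arity q \<le> n"
    using sat Formula_code[OF that(1)] Formula_code[OF that(2)] by simp
  show "opair (code (Forall p)) s \<epsilon> S \<longleftrightarrow>
      (\<forall>x t. x \<epsilon> M \<and> Seq t (Suc n) (case_nat x e) \<longrightarrow> opair (code p) t \<epsilon> S)"
    if "arity p \<le> Suc n"
    using sat Formula_code[OF that] by (simp add: Prepend_iff_Seq[OF s])
qed

text \<open>External induction on \<open>p\<close> works because Tarski's clauses hold at every
  standard length. Nonstandard codes in \<open>S\<close> do not interfere.\<close>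

lemma Satisfaction_code:
  assumes "Satisfaction S M" "arity p \<le> n" "Seq s n e" "\<And>i. e i \<epsilon> M"
  shows "opair (code p) s \<epsilon> S \<longleftrightarrow> sat {x. x \<epsilon> M} E e p"
  using assms(2-)
proof (induction p arbitrary: n s e)
  case (Imp p q)
  have "opair (code p) s \<epsilon> S \<longleftrightarrow> sat {x. x \<epsilon> M} E e p"
    "opair (code q) s \<epsilon> S \<longleftrightarrow> sat {x. x \<epsilon> M} E e q"
    using Imp.prems by (simp_all add: Imp.IH[of n])
  then show ?case
    using Satisfaction_clauses(4)[OF assms(1) Imp.prems(2,3), of p q] Imp.prems(1) by simp
next
  case (Forall p)
  have "opair (code p) t \<epsilon> S \<longleftrightarrow> sat {x. x \<epsilon> M} E (case_nat x e) p"
    if "x \<epsilon> M" "Seq t (Suc n) (case_nat x e)" for x t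
    using Forall.prems that by (intro Forall.IH[of "Suc n"]) (auto split: nat.split)
  moreover have "arity p \<le> Suc n" using Forall.prems(1) by simp
  from Satisfaction_clauses(5)[OF assms(1) Forall.prems(2,3) this]
  have "opair (code (Forall p)) s \<epsilon> S \<longleftrightarrow>
      (\<forall>x t. x \<epsilon> M \<and> Seq t (Suc n) (case_nat x e) \<longrightarrow> opair (code p) t \<epsilon> S)" .
  \<comment> \<open>The clause for quantifiers speaks of all extended assignments \<open>t\<close>;
    \<open>Seq_exists\<close> ensures that each \<open>x\<close> in \<open>M\<close> has
    one.\<close>
  ultimately show ?case using Seq_exists by (simp del: code.simps) metis
qed (use Satisfaction_clauses(1-3)[OF assms(1)] in \<open>simp_all del: code.simps\<close>)

definition Satisfies :: "'a \<Rightarrow> 'a \<Rightarrow> 'a \<Rightarrow> bool" where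
  "Satisfies M c s \<longleftrightarrow> (\<exists>S. Satisfaction S M \<and> opair c s \<epsilon> S)"

lemma holds_satisfies [simp]:
  "M < d \<Longrightarrow> c < d \<Longrightarrow> s < d \<Longrightarrow> H d v (satisfies M c s) \<longleftrightarrow> Satisfies (v M) (v c) (v s)"
  by (simp add: satisfies_def sat_in_def Satisfies_def)

text \<open>Of the ZFC axioms only Powerset is used. It also yields a satisfaction set for \<open>M\<close>.\<close>

definition Model :: "'a \<Rightarrow> bool" where
  "Model M \<longleftrightarrow> (\<forall>y. y \<epsilon> M \<longrightarrow> (\<forall>z. z \<epsilon> y \<longrightarrow> z \<epsilon> M)) \<and> (\<exists>S. Satisfaction S M) \<and>
    (\<forall>e. (\<forall>i. e i \<epsilon> M) \<longrightarrow> sat {x. x \<epsilon> M} E e powerset)"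

text \<open>\<open>Model\<close> supplies a satisfaction set, and by
  \<open>Satisfaction_code\<close> all satisfaction sets give the same verdict on
  \<open>code p\<close>.\<close>

lemma Satisfies_code:
  assumes "Model M" "arity p \<le> n" "Seq s n e" "\<And>i. e i \<epsilon> M"
  shows "Satisfies M (code p) s \<longleftrightarrow> sat {x. x \<epsilon> M} E e p"
  using assms Satisfaction_code[OF _ assms(2-4)] unfolding Satisfies_def Model_def by blast

lemma arity_powerset: "arity powerset = 0"
  by (simp add: powerset_def s_defs is_subset_def Iff_def And_def Neg_def Exists_def)

lemma holds_model:
  assumes "M < d" "H d v (is_model M)" "x \<epsilon> v M"
  shows "Model (v M)"
proof -
  have trans: "\<forall>y. y \<epsilon> v M \<longrightarrow> (\<forall>z. z \<epsilon> y \<longrightarrow> z \<epsilon> v M)"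
    using assms by (simp add: is_model_def)
  have "H (Suc d) (v(d := code powerset)) (is_ZFC_axiom d)"
    unfolding is_ZFC_axiom_def by simp
  then have *: "Satisfies (v M) (code powerset) s"
    if "Natural n" "Formula (code powerset) n" "Into s n (v M)" for n s
    using assms that by (simp add: is_model_def models_def)
  \<comment> \<open>Powerset is a sentence, so its code is a formula with bound \<open>num 0\<close>
    and assignments of length 0 suffice.\<close>
  have sat: "Satisfies (v M) (code powerset) s" if "Seq s 0 e" "\<And>i. e i \<epsilon> v M" for s e
    using that by (intro *[of "num 0"] Formula_code Seq_Into) (auto simp: arity_powerset)
  have S: "\<exists>S. Satisfaction S (v M) \<and> opair (code powerset) s \<epsilon> S"
    if "Seq s 0 e" "\<And>i. e i \<epsilon> v M" for s e
    using sat[OF that] by (simp add: Satisfies_def)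
  obtain s where s: "Seq s 0 (\<lambda>_. x)" using Seq_exists by blast
  have "sat {x. x \<epsilon> v M} E e powerset" if "\<forall>i. e i \<epsilon> v M" for e
  proof -
    obtain s where "Seq s 0 e" using Seq_exists by blast
    then show ?thesis using S[of s e] that Satisfaction_code[of _ "v M" powerset 0 s e]
      by (auto simp: arity_powerset)
  qed
  then show ?thesis using trans S[OF s] assms(3) unfolding Model_def by blast
qed

section \<open>Elementary submodels and Powerset\<close>

definition Elementary :: "'a \<Rightarrow> 'a \<Rightarrow> bool" where
  "Elementary M N \<longleftrightarrow> (\<forall>z. z \<epsilon> M \<longrightarrow> z \<epsilon> N) \<and>
    (\<forall>n c s. Natural n \<and> Formula c n \<and> Into s n M \<longrightarrow> (Satisfies M c s \<longleftrightarrow> Satisfies N c s))"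

lemma holds_elementary [simp]:
  "M < d \<Longrightarrow> N < d \<Longrightarrow> H d v (is_elementary_submodel M N) \<longleftrightarrow> Elementary (v M) (v N)"
  by (simp add: is_elementary_submodel_def Elementary_def)

text \<open>Internal elementarity concerns finite assignments; the segment of \<open>e\<close> of
  length \<open>arity p\<close> determines the truth of \<open>p\<close>.\<close>

lemma Elementary_sat:
  assumes "Model M" "Model N" "Elementary M N" "\<And>i. e i \<epsilon> M"
  shows "sat {x. x \<epsilon> M} E e p \<longleftrightarrow> sat {x. x \<epsilon> N} E e p"
proof -
  obtain s where s: "Seq s (arity p) e" using Seq_exists by blast
  have "Natural (num (arity p)) \<and> Formula (code p) (num (arity p)) \<and> Into s (num (arity p)) M"
    using assms(4) by (auto intro: Formula_code Seq_Into[OF s])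
  then have "Satisfies M (code p) s \<longleftrightarrow> Satisfies N (code p) s"
    using assms(3) unfolding Elementary_def by blast
  moreover have "\<And>i. e i \<epsilon> N" using assms(3,4) by (simp add: Elementary_def)
  ultimately show ?thesis
    using Satisfies_code[OF _ order.refl s] assms(1,2,4) by simp
qed

lemma strongly_extendible:
  obtains M where "x \<epsilon> M" "Model M" "\<And>y. \<exists>N. y \<epsilon> N \<and> Model N \<and> Elementary M N"
proof -
  have "H 0 undefined (\<^bold>\<forall>x. \<^bold>\<exists>M. x \<^bold>\<in> M \<^bold>\<and> is_strongly_extendible M)"
    by (rule ax_holds) (simp add: LZFC_sext_def Loc_sext_ZFC_def)
  then have "\<exists>M. x \<epsilon> M \<and> H 2 (undefined(0 := x, 1 := M)) (is_strongly_extendible 1)"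
    by (simp add: eval_nat_numeral)
  then obtain M v where M: "v 1 = M" "x \<epsilon> M" "H 2 v (is_strongly_extendible 1)"
    by (metis fun_upd_same)
  have "Model M"
    using holds_model[of 1 2 v x] M by (simp add: is_strongly_extendible_def)
  moreover have "\<exists>N. y \<epsilon> N \<and> Model N \<and> Elementary M N" for y
  proof -
    \<comment> \<open>At depth 2 the bound variables \<open>x\<close> and \<open>N\<close> of
      \<open>is_strongly_extendible\<close> receive levels 2 and 3.\<close>
    obtain N where N: "y \<epsilon> N" "H 4 (v(2 := y, 3 := N)) (is_model 3)" "Elementary M N"
      using M by (auto simp: is_strongly_extendible_def eval_nat_numeral)
    then have "Model N" using holds_model[OF _ N(2), of y] by simp
    then show ?thesis using N by blast
  qed
  ultimately show ?thesis using that M(2) by blast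
qed

lemma sat_powerset: "sat UNIV E e powerset"
proof -
  \<comment> \<open>\<open>q\<close> says that index 0 is the power set of index 1; under the two
    inner quantifiers they become 2 and 3.\<close>
  define q where "q = Forall (Iff (Mem 0 1) (Forall (Imp (Mem 0 1) (Mem 0 3))))"
  have powerset: "powerset = Forall (Exists q)"
    by (simp add: powerset_def q_def is_subset_def s_defs eval_nat_numeral)
  have q: "sat {y. y \<epsilon> N} E (case_nat p (case_nat x f)) q \<longleftrightarrow>
      (\<forall>y. y \<epsilon> N \<longrightarrow> (y \<epsilon> p \<longleftrightarrow> (\<forall>z. z \<epsilon> y \<longrightarrow> z \<epsilon> x)))"
    if "Model N" for N p x f
  proof -
    \<comment> \<open>Transitivity of \<open>N\<close> makes inclusion absolute.\<close>
    have "(\<forall>z. z \<epsilon> N \<longrightarrow> z \<epsilon> y \<longrightarrow> z \<epsilon> x) \<longleftrightarrow> (\<forall>z. z \<epsilon> y \<longrightarrow> z \<epsilon> x)" if "y \<epsilon> N" for y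
      using \<open>Model N\<close> that unfolding Model_def by blast
    then show ?thesis by (simp add: q_def eval_nat_numeral)
  qed
  have "\<exists>p. \<forall>y. y \<epsilon> p \<longleftrightarrow> (\<forall>z. z \<epsilon> y \<longrightarrow> z \<epsilon> x)" for x
  proof -
    obtain M where M: "x \<epsilon> M" "Model M" "\<And>y. \<exists>N. y \<epsilon> N \<and> Model N \<and> Elementary M N"
      using strongly_extendible by blast
    have "sat {y. y \<epsilon> M} E (\<lambda>_. x) powerset" using M(1,2) by (simp add: Model_def)
    then obtain p where p: "p \<epsilon> M" "sat {y. y \<epsilon> M} E (case_nat p (case_nat x (\<lambda>_. x))) q"
      using M(1) by (auto simp: powerset)
    have "y \<epsilon> p \<longleftrightarrow> (\<forall>z. z \<epsilon> y \<longrightarrow> z \<epsilon> x)" for y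
    proof -
      obtain N where N: "y \<epsilon> N" "Model N" "Elementary M N" using M(3) by blast
      have "sat {y. y \<epsilon> N} E (case_nat p (case_nat x (\<lambda>_. x))) q"
        using p M(1) by (subst Elementary_sat[OF M(2) N(2,3), symmetric]) (auto split: nat.split)
      then show ?thesis using q[OF N(2)] N(1) by blast
    qed
    then show ?thesis by blast
  qed
  then show ?thesis by (simp add: powerset q_def eval_nat_numeral)
qed

section \<open>Absoluteness of bounded formulas and transfer of existential ones\<close>

text \<open>A bounded quantifier ranges over elements of some \<open>e i\<close>, all of which lie
  in the transitive \<open>N\<close>.\<close>

lemma delta0_absolute:
  assumes "delta0 q" "Model N" "\<And>i. e i \<epsilon> N"
  shows "sat {x. x \<epsilon> N} E e q \<longleftrightarrow> sat UNIV E e q"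
  using assms(1,3)
proof (induction q arbitrary: e)
  case (delta0_ball q i)
  have "x \<epsilon> N" if "x \<epsilon> e i" for x
    using that assms(2) delta0_ball.prems unfolding Model_def by blast
  moreover have "sat {x. x \<epsilon> N} E (case_nat x e) q \<longleftrightarrow> sat UNIV E (case_nat x e) q"
    if "x \<epsilon> N" for x
    using that delta0_ball.prems by (intro delta0_ball.IH) (auto split: nat.split)
  ultimately show ?case by auto
next
  case (delta0_bex q i)
  have "x \<epsilon> N" if "x \<epsilon> e i" for x
    using that assms(2) delta0_bex.prems unfolding Model_def by blast
  moreover have "sat {x. x \<epsilon> N} E (case_nat x e) q \<longleftrightarrow> sat UNIV E (case_nat x e) q"
    if "x \<epsilon> N" for x
    using that delta0_bex.prems by (intro delta0_bex.IH) (auto split: nat.split)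
  ultimately show ?case by auto
qed auto

lemma sigma1_upward:
  assumes "delta0 q" "Model N" "\<And>i. e i \<epsilon> N" "sat {x. x \<epsilon> N} E e ((Exists ^^ n) q)"
  shows "sat UNIV E e ((Exists ^^ n) q)"
  using assms(3,4)
proof (induction n arbitrary: e)
  case 0
  then show ?case using delta0_absolute[OF assms(1,2)] by simp
next
  case (Suc n)
  then obtain x where "x \<epsilon> N" "sat {x. x \<epsilon> N} E (case_nat x e) ((Exists ^^ n) q)" by auto
  then have "sat UNIV E (case_nat x e) ((Exists ^^ n) q)"
    using Suc.prems(1) by (intro Suc.IH) (auto split: nat.split)
  then show ?case by auto
qed

text \<open>The witnesses are gathered in one finite set because strong extendibility captures a
  single set \<open>fset W\<close>; transitivity then captures each witness.\<close>

lemma sigma1_witnesses: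
  assumes "delta0 q" "sat UNIV E e ((Exists ^^ n) q)"
  shows "\<exists>W. finite W \<and> (\<forall>N. Model N \<and> (\<forall>i. e i \<epsilon> N) \<and> (\<forall>w\<in>W. w \<epsilon> N) \<longrightarrow>
    sat {x. x \<epsilon> N} E e ((Exists ^^ n) q))"
  using assms(2)
proof (induction n arbitrary: e)
  case 0
  then show ?case using delta0_absolute[OF assms(1)] by (intro exI[of _ "{}"]) auto
next
  case (Suc n)
  then obtain x where "sat UNIV E (case_nat x e) ((Exists ^^ n) q)" by auto
  from Suc.IH[OF this] obtain W where W: "finite W"
    "\<And>N. Model N \<Longrightarrow> \<forall>i. case_nat x e i \<epsilon> N \<Longrightarrow> \<forall>w\<in>W. w \<epsilon> N \<Longrightarrow>
      sat {x. x \<epsilon> N} E (case_nat x e) ((Exists ^^ n) q)" by blast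
  show ?case
  proof (intro exI[of _ "insert x W"] conjI allI impI)
    fix N assume N: "Model N \<and> (\<forall>i. e i \<epsilon> N) \<and> (\<forall>w\<in>insert x W. w \<epsilon> N)"
    then have "sat {x. x \<epsilon> N} E (case_nat x e) ((Exists ^^ n) q)"
      by (intro W) (auto split: nat.split)
    then show "sat {x. x \<epsilon> N} E e ((Exists ^^ Suc n) q)" using N by auto
  qed (use W in simp)
qed

section \<open>Collection for existential formulas\<close>

lemma sat_collection_iff:
  "sat UNIV E e (collection p) \<longleftrightarrow> (\<forall>a.
    (\<forall>x. x \<epsilon> a \<longrightarrow> (\<exists>y. sat UNIV E (case_nat y (case_nat x (case_nat a e))) p)) \<longrightarrow>
    (\<exists>b. \<forall>x. x \<epsilon> a \<longrightarrow> (\<exists>y. y \<epsilon> b \<and> sat UNIV E (case_nat y (case_nat x (case_nat a e))) p)))"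
proof -
  \<comment> \<open>The variable inserted by \<open>lift 2\<close> is the collecting set
    \<open>b\<close>, which sits behind \<open>y\<close> and \<open>x\<close>.\<close>
  have "(\<lambda>i. case_nat y (case_nat x (case_nat b f)) (if i < 2 then i else Suc i)) =
      case_nat y (case_nat x f)" for y x b :: 'a and f
    by (auto simp: fun_eq_iff split: nat.split)
  then show ?thesis by (simp add: collection_def lift_def sat_ren eval_nat_numeral)
qed

lemma sat_sigma1_collection:
  assumes "sigma1 p"
  shows "sat UNIV E e (collection p)"
  unfolding sat_collection_iff
proof (intro allI impI)
  fix a
  assume total: "\<forall>x. x \<epsilon> a \<longrightarrow> (\<exists>y. sat UNIV E (case_nat y (case_nat x (case_nat a e))) p)"
  obtain n q where q: "delta0 q" "p = (Exists ^^ n) q"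
    using assms unfolding sigma1_def by blast
  \<comment> \<open>The collected value \<open>y\<close> counts as one more witness, so
    \<open>Exists p\<close> has the same form as \<open>p\<close>.\<close>
  then have Ex_p: "Exists p = (Exists ^^ Suc n) q" by simp
  \<comment> \<open>An assignment may take infinitely many values, but only finitely many can be put
    into \<open>M\<close> at once. Those from \<open>arity p\<close> on are therefore replaced by
    \<open>a\<close>, which leaves the truth of \<open>p\<close> unchanged.\<close>
  define e' where "e' i = (if i < arity p then e i else a)" for i
  have e': "sat UNIV E (case_nat y (case_nat x (case_nat a e))) p \<longleftrightarrow>
      sat UNIV E (case_nat y (case_nat x (case_nat a e'))) p" for y x
    by (rule sat_cong) (auto simp: e'_def split: nat.split)
  define F where "F = insert a (e ` {..<arity p})"
  have "finite F" by (simp add: F_def)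
  obtain M where M: "fset F \<epsilon> M" "Model M" "\<And>y. \<exists>N. y \<epsilon> N \<and> Model N \<and> Elementary M N"
    using strongly_extendible by blast
  have trans: "z \<epsilon> N" if "Model N" "y \<epsilon> N" "z \<epsilon> y" for N y z
    using that unfolding Model_def by blast
  have FM: "z \<epsilon> M" if "z \<in> F" for z
    using trans[OF M(2,1)] \<open>finite F\<close> that by simp
  then have aM: "a \<epsilon> M" and e'M: "e' i \<epsilon> M" for i
    by (auto simp: F_def e'_def)
  have "\<exists>y. y \<epsilon> M \<and> sat UNIV E (case_nat y (case_nat x (case_nat a e))) p" if "x \<epsilon> a" for x
  proof -
    define f where "f = case_nat x (case_nat a e')"
    have fM: "f i \<epsilon> M" for i
      using aM e'M trans[OF M(2) aM that] by (auto simp: f_def split: nat.split)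
    have "sat UNIV E f ((Exists ^^ Suc n) q)"
      using total that e' unfolding f_def Ex_p[symmetric] by auto
    from sigma1_witnesses[OF q(1) this] obtain W where W: "finite W"
      "\<And>N. Model N \<Longrightarrow> \<forall>i. f i \<epsilon> N \<Longrightarrow> \<forall>w\<in>W. w \<epsilon> N \<Longrightarrow> sat {x. x \<epsilon> N} E f (Exists p)"
      unfolding Ex_p by blast
    obtain N where N: "fset W \<epsilon> N" "Model N" "Elementary M N" using M(3) by blast
    have "w \<epsilon> N" if "w \<in> W" for w
      using trans[OF N(2,1)] W(1) that by simp
    moreover have "f i \<epsilon> N" for i using fM N(3) by (simp add: Elementary_def)
    ultimately have "sat {x. x \<epsilon> N} E f (Exists p)" using W(2) N(2) by blast
    \<comment> \<open>The assignment \<open>f\<close> stays inside \<open>M\<close>, so elementarity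
      pulls the witnesses found in \<open>N\<close> back to \<open>M\<close>.\<close>
    then have "sat {x. x \<epsilon> M} E f (Exists p)"
      using Elementary_sat[OF M(2) N(2,3), of f] fM by blast
    then obtain y where y: "y \<epsilon> M" "sat {x. x \<epsilon> M} E (case_nat y f) p" by auto
    then have "sat UNIV E (case_nat y f) p"
      unfolding q(2) using fM by (intro sigma1_upward[OF q(1) M(2)]) (auto split: nat.split)
    then show ?thesis using y(1) e' unfolding f_def by blast
  qed
  then show "\<exists>b. \<forall>x. x \<epsilon> a \<longrightarrow> (\<exists>y. y \<epsilon> b \<and>
      sat UNIV E (case_nat y (case_nat x (case_nat a e))) p)" by blast
qed

end

theorem theorem3p10:
  shows "LZFC_sext \<turnstile> powerset \<and>
    (\<forall>p. sigma1 p \<longrightarrow> LZFC_sext \<turnstile> univ_closure (collection p))"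
proof (intro conjI allI impI)
  show "LZFC_sext \<turnstile> powerset"
    by (rule LZFC_sext_completeness, rule LZFC_sext_model.sat_powerset, unfold_locales)
next
  fix p assume "sigma1 p"
  have "LZFC_sext \<turnstile> collection p"
    by (rule LZFC_sext_completeness,
        rule LZFC_sext_model.sat_sigma1_collection[OF _ \<open>sigma1 p\<close>], unfold_locales)
  then show "LZFC_sext \<turnstile> univ_closure (collection p)"
    unfolding univ_closure_def by (rule provable_Forall_pow)
qed

end
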